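(* For each $\alpha \in [0,1]$, the $\alpha$-level set $L_\alpha^* = \{ x \in [0,1] : \lambda^*(x) = \alpha \}$ of the convergence exponent $\lambda^*$ has Hausdorff dimension $1-\alpha$.
   Context: Pierce digits. For $x \in [0,1]$, define $d_1(x) := \lfloor 1/x \rfloor$ and $T(x) := 1 - d_1(x)\,x$ if $x \neq 0$, and $d_1(0) := \infty$, $T(0) := 0$. Here $\lfloor y \rfloor$ is the largest integer not exceeding $y$. For $n \in \mathbb{N} = \{1,2,3,\dots\}$ put $d_n(x) := d_1(T^{n-1}(x))$, where $T^{n-1}$ is the $(n-1)$-fold iterate of $T$ ($T^0$ is the identity). The sequence $(d_n(x))_{n \in \mathbb{N}}$ is the Pierce expansion digit sequence of $x$. Conventions: $\infty^s := \infty$ for $s>0$ and $c/\infty := 0$ for $c \in \mathbb{R}$. Convergence exponent: for $x \in [0,1]$, $\lambda^*(x) := \inf\{ s > 0 : \sum_{n \in \mathbb{N}} 1/(d_n(x))^s \text{ converges} \}$. The function $\lambda^*$ takes values in $[0,1]$. Hausdorff dimension is the usual one: for non-empty $F \subseteq [0,1]$ it is $\inf\{ s \geq 0 : \mathcal{H}^s(F) = 0 \}$, with $\mathcal{H}^s$ the $s$-dimensional Hausdorff measure. *)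

theory Defs
  imports "HOL-Analysis.Analysis"
begin

definition pierce_d1 :: "real \<Rightarrow> enat" where
  "pierce_d1 x = (if x = 0 then \<infinity> else enat (nat \<lfloor>1 / x\<rfloor>))"

definition pierce_T :: "real \<Rightarrow> real" where
  "pierce_T x = (if x = 0 then 0 else 1 - of_int \<lfloor>1 / x\<rfloor> * x)"

text \<open>Digits are indexed from 1; index 0 is junk.\<close>

definition pierce_digit :: "nat \<Rightarrow> real \<Rightarrow> enat" where
  "pierce_digit n x = pierce_d1 ((pierce_T ^^ (n - 1)) x)"

text \<open>The value \<open>1 / d\<^sup>s\<close> for \<open>s > 0\<close>, with \<open>1 / \<infinity>\<^sup>s = 0\<close>.\<close>

definition inverse_enat_powr :: "enat \<Rightarrow> real \<Rightarrow> real" where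
  "inverse_enat_powr d s = (case d of enat k \<Rightarrow> 1 / (real k powr s) | \<infinity> \<Rightarrow> 0)"

text \<open>
  For \<open>x \<in> [0,1]\<close> the finite digits are positive and strictly increasing, so the set below
  contains every \<open>s > 1\<close>, and the real-valued infimum is the intended one.
\<close>

definition convergence_exponent :: "real \<Rightarrow> real" where
  "convergence_exponent x =
     Inf {s. 0 < s \<and> summable (\<lambda>n. inverse_enat_powr (pierce_digit (Suc n) x) s)}"

definition pierce_level_set :: "real \<Rightarrow> real set" where
  "pierce_level_set \<alpha> = {x \<in> {0..1}. convergence_exponent x = \<alpha>}"

text \<open>
  The \<open>s\<close>-th power of the diameter, with the usual conventions that the empty set
  contributes 0 and that \<open>0\<^sup>0 = 1\<close> for non-empty sets; \<open>(powr)\<close> has \<open>0 powr 0 = 0\<close>.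
\<close>

definition diameter_powr :: "real \<Rightarrow> 'a::metric_space set \<Rightarrow> ennreal" where
  "diameter_powr s U =
     (if U = {} then 0 else if s = 0 then 1 else ennreal (diameter U powr s))"

text \<open>
  Boundedness is required explicitly because \<^const>\<open>diameter\<close> is real-valued and hence
  meaningless on unbounded sets. Finite covers are padded with empty sets.
\<close>

definition delta_cover :: "real \<Rightarrow> 'a::metric_space set \<Rightarrow> (nat \<Rightarrow> 'a set) \<Rightarrow> bool" where
  "delta_cover \<delta> F U \<longleftrightarrow> F \<subseteq> (\<Union>i. U i) \<and> (\<forall>i. bounded (U i) \<and> diameter (U i) \<le> \<delta>)"

definition hausdorff_premeasure :: "real \<Rightarrow> real \<Rightarrow> 'a::metric_space set \<Rightarrow> ennreal" where
  "hausdorff_premeasure s \<delta> F = (INF U \<in> {U. delta_cover \<delta> F U}. \<Sum>i. diameter_powr s (U i))"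

definition hausdorff_measure :: "real \<Rightarrow> 'a::metric_space set \<Rightarrow> ennreal" where
  "hausdorff_measure s F = (SUP \<delta> \<in> {0<..}. hausdorff_premeasure s \<delta> F)"

definition hausdorff_dim :: "'a::metric_space set \<Rightarrow> ereal" where
  "hausdorff_dim F = (INF s \<in> {s::real. 0 \<le> s \<and> hausdorff_measure s F = 0}. ereal s)"

end

theory Submission
  imports Defs
begin

text \<open>
  The theorem says that fast growth of the Pierce digits \<open>d\<^sub>n\<close> is cheap and slow growth is expensive:
  digits of order \<open>n powr (1 / \<alpha>)\<close> cost \<open>\<alpha>\<close> in dimension. Two features of the expansion are behind
  it. Digits increase strictly, and the set of points with given first digits \<open>d\<^sub>1, \<dots>, d\<^sub>n\<close> has
  diameter at most \<open>1 / (d\<^sub>1 \<cdots> d\<^sub>n)\<close>, because \<open>pierce_T ^^ n\<close> is affine on it with slope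
  plus or minus \<open>d\<^sub>1 \<cdots> d\<^sub>n\<close>.

  Upper bound. If the convergence exponent of \<open>x\<close> is at least \<open>\<alpha> > r > 0\<close>, then
  \<open>d\<^sub>n \<le> n powr (1 / r)\<close> for infinitely many \<open>n\<close> (\<open>frequently_small_digit\<close>). The first \<open>n\<close> digits of
  such an \<open>x\<close> form an \<open>n\<close>-element subset of \<open>{1..N}\<close> with \<open>N \<approx> n powr (1 / r)\<close>, and the sum of the
  \<open>t\<close>-th powers of the diameters of all these cylinders is bounded by the \<open>n\<close>-th elementary symmetric
  polynomial of the numbers \<open>k powr - t\<close>, \<open>k \<le> N\<close>. Its generating function
  (\<open>sum_subset_products_le\<close>) shows that these bounds are summable over \<open>n\<close> as soon as \<open>1 - t < r\<close>;
  so the \<open>t\<close>-dimensional measure vanishes for all \<open>t \<in> {1 - \<alpha><..<1}\<close>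
  (\<open>hausdorff_measure_superlevel_eq_0\<close>). For \<open>\<alpha> = 0\<close> the bound 1 is that of the unit interval.

  Lower bound. Fix an increasing sequence \<open>m\<close> and consider the points whose \<open>k\<close>-th digit lies in the
  block \<open>{m k..<m (k + 1)}\<close>. For \<open>m k \<approx> 3 * k powr (1 / \<alpha>)\<close>, and for \<open>m k \<approx> 2 ^ k\<close> if \<open>\<alpha> = 0\<close>, they
  all belong to the level set. Copying the digits of the mixed radix expansion with radices
  \<open>m (k + 1) - m k\<close> maps \<open>{0..<1}\<close> into this set. The length of a radix cylinder of order \<open>n\<close> is the
  inverse of the product of the block lengths, the distance between two points whose digits first differ
  at place \<open>n\<close> is roughly the inverse of the product of the \<open>m k\<close>; comparing the two products
  shows that the inverse map is Hoelder continuous with exponent \<open>t\<close> for every \<open>t < 1 - \<alpha>\<close>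
  (\<open>hausdorff_measure_block_set_nonzero\<close>). A set that a Hoelder map of exponent \<open>t\<close> sends onto an interval
  has positive \<open>t\<close>-dimensional measure, by countable subadditivity of Lebesgue measure
  (\<open>hausdorff_measure_nonzeroI\<close>). Since any strictly increasing digit sequence is realized by the sum of
  its alternating Pierce series (\<open>pierce_point_digits\<close>), no limit construction is needed.
\<close>

section \<open>Estimating Hausdorff measures\<close>

lemma diameter_powr_pos_exponent:
  assumes "0 < s"
  shows "diameter_powr s U = ennreal (diameter U powr s)"
  using assms by (auto simp: diameter_powr_def)

text \<open>
  The mesh \<open>\<delta>\<close> takes care of itself: for \<open>s > 0\<close>, a cover with \<open>(\<Sum>U. diameter U powr s) \<le> \<epsilon>\<close> consists of
  sets of diameter at most \<open>\<epsilon> powr (1 / s)\<close>. Arbitrary countable index sets are allowed, and the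
  sum is controlled through its finite partial sums, so that the cylinders below can be indexed by
  finite sets of digits.
\<close>

lemma hausdorff_measure_eq_0I:
  fixes F :: "'a::metric_space set" 
  assumes s: "0 < s"
    and small: "\<And>\<epsilon>. 0 < \<epsilon> \<Longrightarrow> \<exists>(I :: 'i set) U. countable I \<and> F \<subseteq> (\<Union>i\<in>I. U i) \<and>
      (\<forall>i\<in>I. bounded (U i)) \<and> (\<forall>J\<subseteq>I. finite J \<longrightarrow> (\<Sum>j\<in>J. diameter (U j) powr s) \<le> \<epsilon>)"
  shows "hausdorff_measure s F = 0"
proof -
  have "hausdorff_premeasure s \<delta> F \<le> 0 + ennreal e" if \<delta>: "0 < \<delta>" and e: "0 < e" for \<delta> e
  proof -
    define \<epsilon> where "\<epsilon> = min e (\<delta> powr s)"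
    have "0 < \<epsilon>" using \<delta> e by (simp add: \<epsilon>_def)
    from small[OF this] obtain I :: "'i set" and U where I: "countable I"
      and cov: "F \<subseteq> (\<Union>i\<in>I. U i)" and bdd: "\<And>i. i \<in> I \<Longrightarrow> bounded (U i)"
      and sum: "\<And>J. J \<subseteq> I \<Longrightarrow> finite J \<Longrightarrow> (\<Sum>j\<in>J. diameter (U j) powr s) \<le> \<epsilon>"
      by blast
    let ?c = "to_nat_on I"
    have inj: "inj_on ?c I" using I by (rule inj_on_to_nat_on)
    define V where "V n = (if n \<in> ?c ` I then U (the_inv_into I ?c n) else {})" for n
    have V: "V (?c i) = U i" if "i \<in> I" for i
      using that by (simp add: V_def the_inv_into_f_f[OF inj])
    have diam: "diameter (U i) \<le> \<delta>" if "i \<in> I" for i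
    proof -
      have "diameter (U i) powr s \<le> \<delta> powr s"
        using sum[of "{i}"] that by (simp add: \<epsilon>_def)
      then show ?thesis
        using \<delta> s by (meson less_eq_real_def not_le powr_less_mono2)
    qed
    have "delta_cover \<delta> F V"
      unfolding delta_cover_def
    proof (intro conjI allI)
      show "F \<subseteq> (\<Union>n. V n)"
      proof
        fix x assume "x \<in> F"
        then obtain i where "i \<in> I" "x \<in> U i" using cov by auto
        then have "x \<in> V (?c i)" by (simp add: V)
        then show "x \<in> (\<Union>n. V n)" by blast
      qed
    next
      fix n
      have "bounded (V n) \<and> diameter (V n) \<le> \<delta>"
      proof (cases "n \<in> ?c ` I")
        case True
        then obtain i where "i \<in> I" "n = ?c i" by blast
        then show ?thesis using V bdd diam by simp
      next
        case False
        then show ?thesis using \<delta> by (simp add: V_def)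
      qed
      then show "bounded (V n)" "diameter (V n) \<le> \<delta>" by auto
    qed
    then have "hausdorff_premeasure s \<delta> F \<le> (\<Sum>n. diameter_powr s (V n))"
      unfolding hausdorff_premeasure_def by (intro INF_lower) simp
    also have "\<dots> \<le> ennreal e"
      unfolding suminf_eq_SUP
    proof (rule SUP_least)
      fix k :: nat
      define J where "J = {i \<in> I. ?c i < k}"
      have img: "?c ` J = {..<k} \<inter> ?c ` I" by (auto simp: J_def)
      have injJ: "inj_on ?c J" using inj by (rule inj_on_subset) (auto simp: J_def)
      have "finite J" using img finite_imageD[OF _ injJ] by auto
      have "(\<Sum>n<k. diameter_powr s (V n)) = ennreal (\<Sum>n<k. diameter (V n) powr s)"
        by (simp add: diameter_powr_pos_exponent[OF s] sum_ennreal)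
      also have "(\<Sum>n<k. diameter (V n) powr s) = (\<Sum>n\<in>?c ` J. diameter (V n) powr s)"
        unfolding img by (rule sum.mono_neutral_right) (auto simp: V_def)
      also have "\<dots> = (\<Sum>j\<in>J. diameter (U j) powr s)"
        unfolding sum.reindex[OF injJ] by (rule sum.cong) (auto simp: J_def V)
      also have "\<dots> \<le> e"
        using sum[of J] \<open>finite J\<close> by (auto simp: J_def \<epsilon>_def)
      finally show "(\<Sum>n<k. diameter_powr s (V n)) \<le> ennreal e"
        by (simp add: ennreal_leI)
    qed
    finally show ?thesis by simp
  qed
  then have "hausdorff_premeasure s \<delta> F \<le> 0" if "0 < \<delta>" for \<delta>
    by (rule ennreal_le_epsilon) (use that in blast)
  then show ?thesis
    unfolding hausdorff_measure_def by (simp add: SUP_eq_const)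
qed

text \<open>
  A substitute for the mass distribution principle. The inverse of \<open>h\<close> is Hoelder continuous with
  exponent \<open>s\<close>, so the preimage of a set of diameter \<open>r\<close> fits into an interval of length at most
  \<open>2 * K * r powr s\<close>. A cover of \<open>F\<close> thus yields a cover of \<open>{0..<1}\<close> by intervals, whose lengths
  must add up to at least 1.
\<close>

lemma hausdorff_measure_nonzeroI:
  fixes F :: "'a::metric_space set" and h :: "real \<Rightarrow> 'a"
  assumes s: "0 \<le> s"
    and into: "\<And>y. y \<in> {0..<1} \<Longrightarrow> h y \<in> F"
    and expand: "\<And>y z. y \<in> {0..<1} \<Longrightarrow> z \<in> {0..<1} \<Longrightarrow> \<bar>y - z\<bar> \<le> K * dist (h y) (h z) powr s"
  shows "hausdorff_measure s F \<noteq> 0"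
proof -
  define C where "C = max K 1"
  have C: "1 \<le> C" "K \<le> C" by (auto simp: C_def)
  have lower: "1 \<le> ennreal (2 * C) * (\<Sum>i. diameter_powr s (U i))" if U: "delta_cover 1 F U" for U
  proof -
    define V where "V i = {y \<in> {0..<1}. h y \<in> U i}" for i
    \<comment> \<open>The case split reflects the convention \<open>0\<^sup>0 = 1\<close> for the diameter of a one-point set.\<close>
    define \<rho> where "\<rho> i = (if s = 0 then 1 else diameter (U i) powr s)" for i
    define W where "W i = (if V i = {} then {} else
      {(SOME y. y \<in> V i) - C * \<rho> i .. (SOME y. y \<in> V i) + C * \<rho> i})" for i
    have \<rho>: "0 \<le> \<rho> i" for i by (simp add: \<rho>_def)
    have VW: "V i \<subseteq> W i" for i
    proof
      fix z assume z: "z \<in> V i"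
      define y where "y = (SOME y. y \<in> V i)"
      have y: "y \<in> V i" using z by (auto simp: y_def intro: someI)
      have bdd: "bounded (U i)" using U by (simp add: delta_cover_def)
      have "\<bar>y - z\<bar> \<le> C * \<rho> i"
      proof (cases "s = 0")
        case True
        then show ?thesis using y z C by (auto simp: V_def \<rho>_def)
      next
        case False
        have "\<bar>y - z\<bar> \<le> K * dist (h y) (h z) powr s"
          using y z by (intro expand) (auto simp: V_def)
        also have "\<dots> \<le> C * dist (h y) (h z) powr s"
          using C by (intro mult_right_mono) auto
        also have "\<dots> \<le> C * diameter (U i) powr s"
          using C s y z by (intro mult_left_mono powr_mono2 diameter_bounded_bound[OF bdd])
            (auto simp: V_def)
        finally show ?thesis using False by (simp add: \<rho>_def)
      qed
      then show "z \<in> W i" using z by (auto simp: W_def y_def[symmetric])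
    qed
    have "{0..<1} \<subseteq> (\<Union>i. V i)"
      using U into by (fastforce simp: delta_cover_def V_def)
    also have "\<dots> \<subseteq> (\<Union>i. W i)" using VW by (rule UN_mono[OF order_refl])
    finally have "{0..<1} \<subseteq> (\<Union>i. W i)" .
    then have "emeasure lborel {0..<1::real} \<le> emeasure lborel (\<Union>i. W i)"
      by (intro emeasure_mono) (auto simp: W_def)
    also have "\<dots> \<le> (\<Sum>i. emeasure lborel (W i))"
      by (intro emeasure_subadditive_countably) (auto simp: W_def)
    also have "\<dots> \<le> (\<Sum>i. ennreal (2 * C) * diameter_powr s (U i))"
    proof (intro suminf_le summableI)
      fix i
      show "emeasure lborel (W i) \<le> ennreal (2 * C) * diameter_powr s (U i)"
      proof (cases "V i = {}")
        case False
        then have "U i \<noteq> {}" by (auto simp: V_def)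
        then have *: "diameter_powr s (U i) = ennreal (\<rho> i)"
          by (simp add: diameter_powr_def \<rho>_def)
        have "emeasure lborel (W i) = ennreal (2 * C * \<rho> i)"
          using False C \<rho>[of i] by (simp add: W_def)
        then show ?thesis using C \<rho>[of i] by (simp add: * ennreal_mult)
      qed (simp add: W_def)
    qed
    also have "\<dots> = ennreal (2 * C) * (\<Sum>i. diameter_powr s (U i))" by simp
    finally show ?thesis by simp
  qed
  have "ennreal (1 / (2 * C)) \<le> hausdorff_premeasure s 1 F"
    unfolding hausdorff_premeasure_def
  proof (rule INF_greatest)
    fix U assume "U \<in> {U. delta_cover 1 F U}"
    then have "1 \<le> ennreal (2 * C) * (\<Sum>i. diameter_powr s (U i))" using lower by simp
    then have "ennreal (1 / (2 * C)) * 1 \<le>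
        ennreal (1 / (2 * C)) * (ennreal (2 * C) * (\<Sum>i. diameter_powr s (U i)))"
      by (rule mult_left_mono) simp
    also have "\<dots> = (\<Sum>i. diameter_powr s (U i))"
      using C by (simp add: mult.assoc[symmetric] ennreal_mult[symmetric] del: ennreal_suminf_cmult)
    finally show "ennreal (1 / (2 * C)) \<le> (\<Sum>i. diameter_powr s (U i))" by simp
  qed
  also have "\<dots> \<le> hausdorff_measure s F"
    unfolding hausdorff_measure_def by (rule SUP_upper) simp
  finally show ?thesis using C by (auto simp: ennreal_eq_0_iff)
qed

lemma hausdorff_measure_unit_interval_eq_0:
  fixes F :: "real set"
  assumes F: "F \<subseteq> {0..1}" and s: "1 < s"
  shows "hausdorff_measure s F = 0"
proof (rule hausdorff_measure_eq_0I[where 'i = nat])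
  fix \<epsilon> :: real assume "0 < \<epsilon>"
  have "((\<lambda>n. real n powr (1 - s)) \<longlongrightarrow> 0) at_top"
    using s by (intro tendsto_neg_powr filterlim_real_sequentially) auto
  then have "\<forall>\<^sub>F n in at_top. real n powr (1 - s) < \<epsilon> \<and> 0 < n"
    using \<open>0 < \<epsilon>\<close> by (intro eventually_conj order_tendstoD eventually_gt_at_top) auto
  then obtain n where n: "real n powr (1 - s) < \<epsilon>" "0 < n"
    using eventually_happens'[OF sequentially_bot] by blast
  define U where "U i = {real i / n .. (real i + 1) / n}" for i
  have diam: "diameter (U i) = 1 / n" for i
    using n by (simp add: U_def field_simps)
  have "F \<subseteq> (\<Union>i\<in>{..<n}. U i)"
  proof
    fix x assume "x \<in> F"
    then have x: "0 \<le> x" "x \<le> 1" using F by auto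
    \<comment> \<open>Rounding up and subtracting 1 keeps the right end point \<open>x = 1\<close> in the last interval.\<close>
    define i where "i = nat (\<lceil>x * n\<rceil> - 1)"
    show "x \<in> (\<Union>i\<in>{..<n}. U i)"
    proof (cases "x = 0")
      case True
      then show ?thesis using n by (auto simp: U_def intro!: bexI[of _ 0])
    next
      case False
      then have "0 < x * n" using x n by simp
      then have *: "real i = of_int \<lceil>x * n\<rceil> - 1" 
        unfolding i_def by (subst of_nat_nat) auto
      then have i: "real i \<le> x * n" "x * n \<le> real i + 1" "real i < x * n"
        by linarith+
      then have "real i < 1 * real n"
        using x mult_right_mono[of x 1 "real n"] by linarith
      then have "i \<in> {..<n}" by simp
      moreover have "x \<in> U i" using i n by (auto simp: U_def field_simps)
      ultimately show ?thesis by blast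
    qed
  qed
  moreover have "(\<Sum>j\<in>J. diameter (U j) powr s) \<le> \<epsilon>" if "J \<subseteq> {..<n}" for J
  proof -
    have "card J \<le> n" using card_mono[OF _ that] by simp
    then have "(\<Sum>j\<in>J. diameter (U j) powr s) \<le> real n * (1 / n) powr s"
      by (simp add: diam mult_right_mono)
    also have "\<dots> = real n powr (1 - s)"
      using n by (simp add: powr_diff powr_divide)
    finally show ?thesis using n by simp
  qed
  ultimately show "\<exists>(I :: nat set) U. countable I \<and> F \<subseteq> (\<Union>i\<in>I. U i) \<and> (\<forall>i\<in>I. bounded (U i)) \<and>
      (\<forall>J\<subseteq>I. finite J \<longrightarrow> (\<Sum>j\<in>J. diameter (U j) powr s) \<le> \<epsilon>)"
    by (intro exI[of _ "{..<n}"] exI[of _ U]) (auto simp: U_def)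
qed (use s in simp)

section \<open>Pierce digits and cylinders\<close>

text \<open>
  Digits are numbered from 0 here; the value 0 stands for an infinite digit.
\<close>

definition digit :: "nat \<Rightarrow> real \<Rightarrow> nat" where
  "digit k x = nat \<lfloor>1 / (pierce_T ^^ k) x\<rfloor>"

lemma pierce_digit_Suc:
  "pierce_digit (Suc k) x = (if (pierce_T ^^ k) x = 0 then \<infinity> else enat (digit k x))"
  by (simp add: pierce_digit_def pierce_d1_def digit_def)

lemma pierce_step:
  assumes x: "0 < x" "x \<le> 1" and d: "d = nat \<lfloor>1 / x\<rfloor>"
  shows "1 \<le> d" "1 / (real d + 1) < x" "x \<le> 1 / real d"
    "pierce_T x = 1 - real d * x" "0 \<le> pierce_T x" "pierce_T x < 1 / (real d + 1)"
proof -
  have "1 \<le> 1 / x" using x by simp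
  then have "1 \<le> \<lfloor>1 / x\<rfloor>" by (simp add: le_floor_iff)
  then have int: "int d = \<lfloor>1 / x\<rfloor>" and d1: "1 \<le> d" using d by linarith+
  have fl: "real d = of_int \<lfloor>1 / x\<rfloor>" by (simp flip: int)
  have lo: "real d \<le> 1 / x" and hi: "1 / x < real d + 1" unfolding fl by linarith+
  show "1 \<le> d" by (fact d1)
  show low: "1 / (real d + 1) < x" using hi x d1 by (simp add: field_simps)
  show up: "x \<le> 1 / real d" using lo x d1 by (simp add: field_simps)
  show T: "pierce_T x = 1 - real d * x" using x by (simp add: pierce_T_def fl)
  show "0 \<le> pierce_T x" using up d1 by (simp add: T field_simps)
  have "real d * (1 / (real d + 1)) < real d * x" using low d1 by (intro mult_strict_left_mono) auto
  then show "pierce_T x < 1 / (real d + 1)" using d1 by (simp add: T field_simps)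
qed

lemma pierce_T_0 [simp]: "pierce_T 0 = 0"
  by (simp add: pierce_T_def)

lemma pierce_orbit_unit:
  assumes "x \<in> {0..1}"
  shows "(pierce_T ^^ k) x \<in> {0..1}"
proof (induction k)
  case (Suc k)
  let ?u = "(pierce_T ^^ k) x"
  show ?case
  proof (cases "?u = 0")
    case False
    then have u: "0 < ?u" "?u \<le> 1" using Suc by auto
    note step = pierce_step[OF u refl]
    have "1 / (real (nat \<lfloor>1 / ?u\<rfloor>) + 1) \<le> 1" by simp
    then have "pierce_T ?u \<le> 1" using step(6) by linarith
    then show ?thesis using step(5) by simp
  qed simp
qed (use assms in simp)

lemma pierce_orbit_step:
  assumes x: "x \<in> {0..1}" and nz: "(pierce_T ^^ k) x \<noteq> 0"
  shows "1 \<le> digit k x" "1 / (real (digit k x) + 1) < (pierce_T ^^ k) x"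
    "(pierce_T ^^ k) x \<le> 1 / real (digit k x)"
    "(pierce_T ^^ Suc k) x = 1 - real (digit k x) * (pierce_T ^^ k) x"
    "(pierce_T ^^ Suc k) x < 1 / (real (digit k x) + 1)"
  using pierce_step[of "(pierce_T ^^ k) x" "digit k x"] pierce_orbit_unit[OF x, of k] nz
  by (auto simp: digit_def)

lemma pierce_orbit_zero_stays:
  assumes "(pierce_T ^^ k) x = 0" "k \<le> n"
  shows "(pierce_T ^^ n) x = 0"
  using assms(2) by (induction n rule: dec_induct) (auto simp: assms(1))

lemma digit_strict_mono:
  assumes x: "x \<in> {0..1}" and nz: "(pierce_T ^^ Suc k) x \<noteq> 0"
  shows "digit k x < digit (Suc k) x"
proof -
  have nz': "(pierce_T ^^ k) x \<noteq> 0" using nz by auto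
  have "1 / (real (digit (Suc k) x) + 1) < 1 / (real (digit k x) + 1)"
    using pierce_orbit_step(2)[OF x nz] pierce_orbit_step(5)[OF x nz'] by linarith
  then show ?thesis by (simp add: field_simps)
qed

lemma digit_mono_on_orbit:
  assumes x: "x \<in> {0..1}" and nz: "(pierce_T ^^ n) x \<noteq> 0" and "i < j" "j \<le> n"
  shows "digit i x < digit j x"
  using \<open>i < j\<close> \<open>j \<le> n\<close>
proof (induction j)
  case (Suc j)
  have "(pierce_T ^^ Suc j) x \<noteq> 0"
    using pierce_orbit_zero_stays[of "Suc j" x n] nz Suc.prems by auto
  from digit_strict_mono[OF x this] show ?case
    using Suc by (cases "i = j") auto
qed simp

text \<open>
  On a cylinder of order \<open>n\<close> the map \<open>pierce_T ^^ n\<close> is affine, with slope plus or minus the product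
  of the first \<open>n\<close> digits.
\<close>

lemma pierce_orbit_diff:
  assumes x: "x \<in> {0..1}" and y: "y \<in> {0..1}"
    and nz: "\<And>k. k < n \<Longrightarrow> (pierce_T ^^ k) x \<noteq> 0" "\<And>k. k < n \<Longrightarrow> (pierce_T ^^ k) y \<noteq> 0"
    and eq: "\<And>k. k < n \<Longrightarrow> digit k x = digit k y"
  shows "\<bar>(pierce_T ^^ n) x - (pierce_T ^^ n) y\<bar> = (\<Prod>k<n. real (digit k x)) * \<bar>x - y\<bar>"
  using nz eq
proof (induction n)
  case (Suc n)
  have "(pierce_T ^^ Suc n) x - (pierce_T ^^ Suc n) y =
      - (real (digit n x) * ((pierce_T ^^ n) x - (pierce_T ^^ n) y))"
    using pierce_orbit_step(4)[OF x Suc.prems(1)[OF lessI]]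
      pierce_orbit_step(4)[OF y Suc.prems(2)[OF lessI]] Suc.prems(3)[OF lessI]
    by (simp only: algebra_simps)
  then have "\<bar>(pierce_T ^^ Suc n) x - (pierce_T ^^ Suc n) y\<bar> =
      real (digit n x) * \<bar>(pierce_T ^^ n) x - (pierce_T ^^ n) y\<bar>"
    by (simp only: abs_minus abs_mult abs_of_nat)
  also have "\<dots> = (\<Prod>k<Suc n. real (digit k x)) * \<bar>x - y\<bar>"
    using Suc by simp
  finally show ?case .
qed simp

text \<open>
  Let \<open>u\<close> and \<open>v\<close> be the two orbit points and \<open>k\<close> the digit of \<open>v\<close>. Then \<open>u\<close> lies to the right of
  \<open>1 / k\<close>, while \<open>1 / k - v = pierce_T v / k\<close>; the next digit bounds \<open>pierce_T v\<close> from below. The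
  estimate is the same for adjacent and for distant digits.
\<close>

lemma pierce_separation:
  assumes x: "x \<in> {0..1}" "(pierce_T ^^ n) x \<noteq> 0"
    and y: "y \<in> {0..1}" "(pierce_T ^^ Suc n) y \<noteq> 0"
    and less: "digit n x < digit n y"
  shows "1 / (real (digit n y) * (real (digit (Suc n) y) + 1)) \<le>
    \<bar>(pierce_T ^^ n) x - (pierce_T ^^ n) y\<bar>"
proof -
  let ?u = "(pierce_T ^^ n) x" and ?v = "(pierce_T ^^ n) y"
  let ?w = "(pierce_T ^^ Suc n) y"
  have nz: "?v \<noteq> 0" using y(2) by auto
  define k where "k = real (digit n y)"
  define l where "l = real (digit (Suc n) y)"
  have k: "1 \<le> k" using pierce_orbit_step(1)[OF y(1) nz] by (simp add: k_def)
  have w: "?w = 1 - k * ?v" using pierce_orbit_step(4)[OF y(1) nz] by (simp add: k_def)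
  have "1 / (l + 1) < ?w" using pierce_orbit_step(2)[OF y] by (simp add: l_def)
  then have "(1 / (l + 1)) / k \<le> ?w / k" using k by (intro divide_right_mono) auto
  also have "\<dots> = 1 / k - ?v" using k unfolding w by (simp add: field_simps)
  finally have v: "1 / (k * (l + 1)) \<le> 1 / k - ?v" by (simp add: mult.commute)
  have "1 / k \<le> 1 / (real (digit n x) + 1)"
    using less by (intro divide_left_mono) (auto simp: k_def)
  also have "\<dots> < ?u" using pierce_orbit_step(2)[OF x] .
  finally show ?thesis using v by (simp add: k_def l_def)
qed

text \<open>
  Digits increase strictly, so the set of the first \<open>n\<close> digits determines their order. Indexing
  cylinders by sets instead of sequences turns the sum over all cylinders into an elementary symmetric
  polynomial.
\<close>

definition cylinder :: "nat set \<Rightarrow> real set" where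
  "cylinder S = {x \<in> {0..1}. (\<forall>k < card S. (pierce_T ^^ k) x \<noteq> 0) \<and>
     map (\<lambda>k. digit k x) [0..<card S] = sorted_list_of_set S}"

lemma cylinder_digits:
  assumes "x \<in> cylinder S" "y \<in> cylinder S" "k < card S"
  shows "digit k x = digit k y"
proof -
  have "map (\<lambda>k. digit k x) [0..<card S] ! k = map (\<lambda>k. digit k y) [0..<card S] ! k"
    using assms by (simp only: cylinder_def mem_Collect_eq)
  then show ?thesis using assms(3) by simp
qed

lemma cylinder_digit_prod:
  assumes "x \<in> cylinder S" "finite S"
  shows "(\<Prod>k<card S. real (digit k x)) = (\<Prod>k\<in>S. real k)"
proof -
  have list: "map (\<lambda>k. digit k x) [0..<card S] = sorted_list_of_set S"
    using assms by (simp add: cylinder_def)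
  have "(\<Prod>k<card S. real (digit k x)) = prod_list (map real (map (\<lambda>k. digit k x) [0..<card S]))"
    by (simp add: prod.list_conv_set_nth atLeast0LessThan comp_def)
  also have "\<dots> = (\<Prod>k\<in>S. real k)"
    unfolding list using assms(2)
    by (subst prod.distinct_set_conv_list[symmetric]) auto
  finally show ?thesis .
qed

lemma diameter_cylinder_le:
  assumes S: "finite S"
  shows "bounded (cylinder S)" "diameter (cylinder S) \<le> 1 / (\<Prod>k\<in>S. real k)"
proof -
  show "bounded (cylinder S)"
    by (rule bounded_subset[of "{0..1}"]) (auto simp: cylinder_def)
  have P: "0 \<le> (\<Prod>k\<in>S. real k)" by (intro prod_nonneg) auto
  show "diameter (cylinder S) \<le> 1 / (\<Prod>k\<in>S. real k)"
  proof (rule diameter_le)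
    fix x y assume xy: "x \<in> cylinder S" "y \<in> cylinder S"
    then have unit: "x \<in> {0..1}" "y \<in> {0..1}" by (auto simp: cylinder_def)
    have "(\<Prod>k\<in>S. real k) * \<bar>x - y\<bar> = \<bar>(pierce_T ^^ card S) x - (pierce_T ^^ card S) y\<bar>"
      unfolding cylinder_digit_prod[OF xy(1) S, symmetric]
      by (rule pierce_orbit_diff[symmetric, OF unit _ _ cylinder_digits[OF xy]])
        (use xy in \<open>auto simp: cylinder_def\<close>)
    also have "\<dots> \<le> 1"
      using pierce_orbit_unit[OF unit(1), of "card S"] pierce_orbit_unit[OF unit(2), of "card S"]
      by (simp add: abs_le_iff)
    finally have le: "(\<Prod>k\<in>S. real k) * \<bar>x - y\<bar> \<le> 1" .
    have "(\<Prod>k<card S. real (digit k x)) \<noteq> 0"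
      using xy(1) pierce_orbit_step(1)[OF unit(1)] by (fastforce simp: cylinder_def)
    then have "0 < (\<Prod>k\<in>S. real k)" using cylinder_digit_prod[OF xy(1) S] P by simp
    then show "norm (x - y) \<le> 1 / (\<Prod>k\<in>S. real k)"
      using le by (simp add: field_simps)
  qed (use P in simp)
qed

lemma mem_cylinder_digit_image:
  assumes x: "x \<in> {0..1}" and nz: "(pierce_T ^^ n) x \<noteq> 0"
  defines "S \<equiv> (\<lambda>k. digit k x) ` {..n}"
  shows "x \<in> cylinder S" "card S = Suc n" "S \<subseteq> {1..digit n x}"
proof -
  have mono: "digit i x < digit j x" if "i < j" "j \<le> n" for i j
    using digit_mono_on_orbit[OF x nz that] .
  have orbit: "(pierce_T ^^ k) x \<noteq> 0" if "k \<le> n" for k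
    using pierce_orbit_zero_stays[of k x n] nz that by auto
  have inj: "inj_on (\<lambda>k. digit k x) {..n}"
    by (rule linorder_inj_onI) (use mono in \<open>auto simp: less_le\<close>)
  show card: "card S = Suc n" unfolding S_def using card_image[OF inj] by simp
  have "sorted_wrt (<) (map (\<lambda>k. digit k x) [0..<Suc n])"
    unfolding sorted_wrt_iff_nth_less using mono by (auto simp del: upt_Suc)
  moreover have "set (map (\<lambda>k. digit k x) [0..<Suc n]) = S"
    by (auto simp: S_def simp del: upt_Suc)
  ultimately have "map (\<lambda>k. digit k x) [0..<Suc n] = sorted_list_of_set S"
    by (metis sorted_list_of_set.idem_if_sorted_distinct strict_sorted_iff)
  then show "x \<in> cylinder S"
    using x orbit unfolding cylinder_def card by (auto simp del: upt_Suc)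
  show "S \<subseteq> {1..digit n x}"
  proof
    fix d assume "d \<in> S"
    then obtain k where k: "k \<le> n" "d = digit k x" by (auto simp: S_def)
    show "d \<in> {1..digit n x}"
      using pierce_orbit_step(1)[OF x orbit[OF k(1)]] mono[of k n] k by (cases "k = n") auto
  qed
qed

section \<open>The convergence exponent\<close>

lemma inverse_enat_powr_enat: "inverse_enat_powr (enat d) s = 1 / real d powr s"
  by (simp add: inverse_enat_powr_def)

lemma convergence_exponent_eqI:
  assumes "0 \<le> \<alpha>"
    and "\<And>s. \<alpha> < s \<Longrightarrow> summable (\<lambda>n. inverse_enat_powr (pierce_digit (Suc n) x) s)"
    and "\<And>s. 0 < s \<Longrightarrow> s \<le> \<alpha> \<Longrightarrow> \<not> summable (\<lambda>n. inverse_enat_powr (pierce_digit (Suc n) x) s)"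
  shows "convergence_exponent x = \<alpha>"
proof -
  have "{s. 0 < s \<and> summable (\<lambda>n. inverse_enat_powr (pierce_digit (Suc n) x) s)} = {\<alpha><..}"
    using assms by (force simp: not_le[symmetric])
  then show ?thesis unfolding convergence_exponent_def by simp
qed

lemma divergent_below_convergence_exponent:
  assumes "0 < s" "s < convergence_exponent x"
  shows "\<not> summable (\<lambda>n. inverse_enat_powr (pierce_digit (Suc n) x) s)"
proof
  assume "summable (\<lambda>n. inverse_enat_powr (pierce_digit (Suc n) x) s)"
  then have "convergence_exponent x \<le> s"
    unfolding convergence_exponent_def using assms(1)
    by (intro cInf_lower) (auto intro!: bdd_belowI[of _ 0])
  then show False using assms(2) by simp
qed

text \<open>
  Otherwise the digits would eventually exceed \<open>n powr (1 / r)\<close>, and the digit series would converge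
  for every exponent \<open>s > r\<close>, in particular for some \<open>s\<close> below the convergence exponent.
\<close>

lemma frequently_small_digit:
  assumes x: "x \<in> {0..1}" and r: "0 < r" "r < convergence_exponent x"
  shows "\<exists>n\<ge>n0. (pierce_T ^^ n) x \<noteq> 0 \<and> real (digit n x) \<le> real (Suc n) powr (1 / r)"
proof (rule ccontr)
  assume neg: "\<not> ?thesis"
  \<comment> \<open>The strict gap between \<open>r\<close> and \<open>s\<close> makes the exponent \<open>s / r\<close> exceed 1.\<close>
  obtain s where s: "r < s" "s < convergence_exponent x" using dense[OF r(2)] by blast
  have "summable (\<lambda>n. real n powr - (s / r))"
    using r s by (subst summable_real_powr_iff) (simp add: field_simps)
  then have "summable (\<lambda>n. real (Suc n) powr - (s / r))"
    by (subst summable_Suc_iff)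
  then have "summable (\<lambda>n. inverse_enat_powr (pierce_digit (Suc n) x) s)"
  proof (rule summable_comparison_test_ev[rotated])
    have "norm (inverse_enat_powr (pierce_digit (Suc n) x) s) \<le> real (Suc n) powr - (s / r)"
      if "n0 \<le> n" for n
    proof (cases "(pierce_T ^^ n) x = 0")
      case False
      then have large: "real (Suc n) powr (1 / r) < real (digit n x)"
        using neg that False by (meson linorder_not_le)
      have "real (Suc n) powr (s / r) = (real (Suc n) powr (1 / r)) powr s"
        by (simp add: powr_powr)
      also have "\<dots> \<le> real (digit n x) powr s"
        using large r s by (intro powr_mono2) auto
      finally have "1 / real (digit n x) powr s \<le> 1 / real (Suc n) powr (s / r)"
        using pierce_orbit_step(1)[OF x False] by (intro divide_left_mono mult_pos_pos) auto
      then show ?thesis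
        using False by (simp add: pierce_digit_Suc inverse_enat_powr_enat powr_minus_divide)
    qed (simp add: pierce_digit_Suc inverse_enat_powr_def)
    then show "\<forall>\<^sub>F n in sequentially.
        norm (inverse_enat_powr (pierce_digit (Suc n) x) s) \<le> real (Suc n) powr - (s / r)"
      by (auto simp: eventually_sequentially)
  qed
  moreover have "0 < s" using r s by simp
  ultimately show False using divergent_below_convergence_exponent s by blast
qed

section \<open>Points with prescribed digits\<close>

text \<open>
  The alternating Pierce series \<open>1/d\<^sub>0 - 1/(d\<^sub>0 d\<^sub>1) + 1/(d\<^sub>0 d\<^sub>1 d\<^sub>2) - \<dots>\<close>, with digits numbered from 0.
\<close>

definition pierce_point :: "(nat \<Rightarrow> nat) \<Rightarrow> real" where
  "pierce_point d = (\<Sum>i. (-1) ^ i * (1 / (\<Prod>j\<le>i. real (d j))))"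

lemma strict_mono_ge_Suc:
  assumes "strict_mono d" "1 \<le> d 0"
  shows "Suc i \<le> (d i :: nat)"
proof (induction i)
  case (Suc i)
  then show ?case using strict_monoD[OF assms(1), of i "Suc i"] by simp
qed (use assms in simp)

text \<open>
  Splitting off the first term gives the recursion; the Leibniz criterion supplies convergence and
  bounds the value between the first two partial sums.
\<close>

lemma pierce_point_recursion:
  assumes d: "strict_mono d" "1 \<le> d 0"
  shows "pierce_point d = (1 - pierce_point (\<lambda>i. d (Suc i))) / real (d 0)"
    and "0 < pierce_point d" "pierce_point d \<le> 1 / real (d 0)"
proof -
  define a where "a i = 1 / (\<Prod>j\<le>i. real (d j))" for i
  have ge: "Suc i \<le> d i" for i using strict_mono_ge_Suc[OF d] .
  have pos: "0 < (\<Prod>j\<le>i. real (d j))" for i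
    using ge by (intro prod_pos) (auto intro: less_le_trans[OF zero_less_Suc])
  have step: "a (Suc i) = a i * (1 / real (d (Suc i)))" for i
    by (simp add: a_def)
  have head: "a (Suc i) = 1 / real (d 0) * (1 / (\<Prod>j\<le>i. real (d (Suc j))))" for i
    unfolding a_def prod.atMost_Suc_shift by simp
  have anon: "0 < a i" for i using pos by (simp add: a_def)
  have inv: "1 / real (d i) \<le> 1 / real (Suc i)" for i
    using ge[of i] by (intro divide_left_mono) auto
  have "a (Suc i) \<le> a i * 1" for i
    unfolding step using anon[of i] inv[of "Suc i"] ge[of "Suc i"] by (intro mult_left_mono) auto
  then have dec: "decseq a" by (intro decseq_SucI) simp
  have "a i \<le> 1 / real (Suc i)" for i
  proof (cases i)
    case (Suc j)
    have "a i \<le> 1 * (1 / real (Suc i))"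
      unfolding Suc step
    proof (intro mult_mono)
      show "a j \<le> 1" using decseqD[OF dec, of 0 j] inv[of 0] by (simp add: a_def)
    qed (use inv[of "Suc j"] in auto)
    then show ?thesis by simp
  qed (use inv[of 0] in \<open>simp add: a_def\<close>)
  then have lim: "a \<longlonglongrightarrow> 0"
    using anon by (intro real_tendsto_sandwich[OF _ _ tendsto_const LIMSEQ_inverse_real_of_nat])
      (auto simp: less_imp_le inverse_eq_divide)
  have mono: "monoseq a" using dec by (simp add: decseq_imp_monoseq)
  note leibniz = summable_Leibniz[OF lim mono]
  have eq: "pierce_point d = (\<Sum>i. (-1) ^ i * a i)"
    by (simp add: pierce_point_def a_def)
  have range: "pierce_point d \<in> {\<Sum>i<2*n. (-1) ^ i * a i .. \<Sum>i<2*n+1. (-1) ^ i * a i}" for n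
    unfolding eq using leibniz(2) anon[of 0] by blast
  show "pierce_point d \<le> 1 / real (d 0)"
    using range[of 0] by (simp add: a_def)
  have "a 0 - a 1 \<le> pierce_point d" using range[of 1] by (simp add: numeral_2_eq_2)
  moreover have "a 1 < a 0"
  proof -
    have "1 / real (d (Suc 0)) < 1" using ge[of "Suc 0"] by simp
    then have "a 0 * (1 / real (d (Suc 0))) < a 0 * 1"
      using anon[of 0] by (intro mult_strict_left_mono)
    then show ?thesis using step[of 0] by simp
  qed
  ultimately show "0 < pierce_point d" by linarith
  have "(\<Sum>i. (-1) ^ Suc i * a (Suc i)) = pierce_point d - a 0"
    unfolding eq using suminf_split_head[OF leibniz(1)] by simp
  moreover have "(-1) ^ Suc i * a (Suc i) =
      (- 1 / real (d 0)) * ((-1) ^ i * (1 / (\<Prod>j\<le>i. real (d (Suc j)))))" for i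
    unfolding head by simp
  moreover have "summable (\<lambda>i. (-1) ^ i * (1 / (\<Prod>j\<le>i. real (d (Suc j)))))"
  proof -
    have "summable (\<lambda>i. (- real (d 0)) * ((-1) ^ Suc i * a (Suc i)))"
      using leibniz(1) summable_Suc_iff[of "\<lambda>i. (-1) ^ i * a i"] by (intro summable_mult) blast
    moreover have "(- real (d 0)) * ((-1) ^ Suc i * a (Suc i)) =
        (-1) ^ i * (1 / (\<Prod>j\<le>i. real (d (Suc j))))" for i
      using ge[of 0] unfolding head by simp
    ultimately show ?thesis by (simp only:)
  qed
  ultimately have "(- 1 / real (d 0)) * pierce_point (\<lambda>i. d (Suc i)) = pierce_point d - a 0"
    unfolding pierce_point_def by (simp only: suminf_mult)
  then show "pierce_point d = (1 - pierce_point (\<lambda>i. d (Suc i))) / real (d 0)"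
    by (simp add: a_def diff_divide_distrib)
qed

text \<open>
  The tail \<open>p\<close> of the series satisfies \<open>p < 1 / d\<^sub>1 \<le> 1 / (d\<^sub>0 + 1)\<close>. The strict inequality excludes the
  boundary value, at which \<open>1 / x = d\<^sub>0 + 1\<close> and the first digit would be too large; it holds because
  the expansion does not stop at \<open>d\<^sub>1\<close>.
\<close>

lemma pierce_point_first_digit:
  assumes d: "strict_mono d" "1 \<le> d 0"
  shows "nat \<lfloor>1 / pierce_point d\<rfloor> = d 0"
    and "pierce_T (pierce_point d) = pierce_point (\<lambda>i. d (Suc i))"
proof -
  define d' where "d' = (\<lambda>i. d (Suc i))"
  define d'' where "d'' = (\<lambda>i. d (Suc (Suc i)))"
  have lt: "d 0 < d 1" using strict_monoD[OF d(1)] by simp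
  have d': "strict_mono d'" "1 \<le> d' 0" and d'': "strict_mono d''" "1 \<le> d'' 0"
    using d lt strict_mono_ge_Suc[OF d, of 1] strict_mono_ge_Suc[OF d, of 2]
    by (auto simp: d'_def d''_def strict_mono_def numeral_2_eq_2)
  define x p where "x = pierce_point d" and "p = pierce_point d'"
  have x: "x = (1 - p) / real (d 0)" "0 < x" and p: "0 < p"
    using pierce_point_recursion[OF d] pierce_point_recursion[OF d']
    by (simp_all add: x_def p_def d'_def)
  have "p = (1 - pierce_point d'') / real (d 1)" "0 < pierce_point d''"
    using pierce_point_recursion[OF d'] pierce_point_recursion[OF d'']
    by (simp_all add: p_def d'_def d''_def)
  then have "p < 1 / real (d 1)" using lt by (simp add: divide_strict_right_mono)
  also have "\<dots> \<le> 1 / (real (d 0) + 1)" using lt by (intro divide_left_mono) auto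
  finally have p_less: "p < 1 / (real (d 0) + 1)" .
  also have "\<dots> \<le> 1" by simp
  finally have "p < 1" .
  have "real (d 0) \<le> 1 / x" using x p \<open>p < 1\<close> d(2) by (simp add: field_simps)
  moreover have "1 / x < real (d 0) + 1"
  proof -
    have "real (d 0) < (real (d 0) + 1) * (1 - p)" using p_less by (simp add: field_simps)
    then have "real (d 0) / (1 - p) < real (d 0) + 1" using \<open>p < 1\<close> by (simp add: field_simps)
    then show ?thesis by (simp add: x(1))
  qed
  ultimately have fl: "\<lfloor>1 / x\<rfloor> = int (d 0)" by (simp add: floor_eq_iff)
  then show "nat \<lfloor>1 / pierce_point d\<rfloor> = d 0" by (simp add: x_def)
  have "pierce_T x = 1 - real (d 0) * x"
    using x(2) by (simp add: pierce_T_def fl)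
  also have "\<dots> = p" using d(2) by (simp add: x(1))
  finally show "pierce_T (pierce_point d) = pierce_point (\<lambda>i. d (Suc i))"
    by (simp add: x_def p_def d'_def)
qed

lemma pierce_point_digits:
  assumes d: "strict_mono d" "1 \<le> d 0"
  shows "pierce_point d \<in> {0..1}" "(pierce_T ^^ k) (pierce_point d) \<noteq> 0"
    "digit k (pierce_point d) = d k"
proof -
  have shift: "strict_mono (\<lambda>i. d (i + k))" "1 \<le> d (0 + k)" for k
    using d strict_mono_ge_Suc[OF d, of k] by (auto simp: strict_mono_def)
  have orbit: "(pierce_T ^^ k) (pierce_point d) = pierce_point (\<lambda>i. d (i + k))" for k
    by (induction k) (simp_all add: pierce_point_first_digit(2)[OF shift])
  show "pierce_point d \<in> {0..1}"
    using pierce_point_recursion(2,3)[OF d] d(2) by (auto intro: order_trans[of _ "1 / real (d 0)"])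
  show "(pierce_T ^^ k) (pierce_point d) \<noteq> 0"
    using pierce_point_recursion(2)[OF shift[of k]] by (simp add: orbit)
  show "digit k (pierce_point d) = d k"
    using pierce_point_first_digit(1)[OF shift, of k] by (simp add: digit_def orbit)
qed

section \<open>The upper bound\<close>

text \<open>
  The left-hand side is the elementary symmetric polynomial \<open>e\<^sub>n\<close>, a coefficient of
  \<open>\<Prod>k\<in>A. 1 + z * w k\<close>. All other coefficients are nonnegative, hence \<open>z ^ n * e\<^sub>n\<close> is at most this
  product, which \<open>1 + x \<le> exp x\<close> bounds further. The parameter \<open>z\<close> is left free to be optimized.
\<close>

lemma sum_subset_products_le:
  fixes w :: "'a \<Rightarrow> real"
  assumes A: "finite A" and w: "\<And>k. k \<in> A \<Longrightarrow> 0 \<le> w k" and z: "0 < z"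
  shows "(\<Sum>S | S \<subseteq> A \<and> card S = n. \<Prod>k\<in>S. w k) \<le> exp (z * (\<Sum>k\<in>A. w k)) / z ^ n"
proof -
  have zw: "0 \<le> z * w k" if "k \<in> A" for k using w z that by simp
  have "z ^ n * (\<Sum>S | S \<subseteq> A \<and> card S = n. \<Prod>k\<in>S. w k) =
      (\<Sum>S | S \<subseteq> A \<and> card S = n. \<Prod>k\<in>S. z * w k)"
    unfolding sum_distrib_left by (rule sum.cong) (auto simp: prod.distrib)
  also have "\<dots> \<le> (\<Sum>S\<in>Pow A. \<Prod>k\<in>S. z * w k)"
    using A zw by (intro sum_mono2) (auto intro!: prod_nonneg)
  also have "\<dots> = (\<Prod>k\<in>A. z * w k + 1)"
    using prod_add[OF A, of "\<lambda>k. z * w k" "\<lambda>_. 1"] by simp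
  also have "\<dots> \<le> (\<Prod>k\<in>A. exp (z * w k))"
    using zw by (intro prod_mono) (auto simp: add.commute exp_ge_add_one_self)
  also have "\<dots> = exp (z * (\<Sum>k\<in>A. w k))"
    using A by (simp add: exp_sum sum_distrib_left)
  finally show ?thesis using z by (simp add: field_simps)
qed

text \<open>
  The sum has order \<open>N powr (1 - t)\<close>. Giving up an arbitrarily small power, \<open>p > 1 - t\<close>, makes a
  comparison with a convergent zeta series sufficient.
\<close>

lemma sum_powr_le:
  fixes t p :: real
  assumes "1 < t + p" "0 \<le> p"
  obtains C where "0 \<le> C" "\<And>N. (\<Sum>k\<in>{1..N}. real k powr - t) \<le> C * real N powr p"
proof
  have sm: "summable (\<lambda>k. real k powr - (t + p))"
    using assms by (subst summable_real_powr_iff) simp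
  define C where "C = (\<Sum>k. real k powr - (t + p))"
  show "0 \<le> C" unfolding C_def by (intro suminf_nonneg[OF sm]) simp
  show "(\<Sum>k\<in>{1..N}. real k powr - t) \<le> C * real N powr p" for N
  proof -
    have "(\<Sum>k\<in>{1..N}. real k powr - t) \<le> (\<Sum>k\<in>{1..N}. real k powr - (t + p) * real N powr p)"
    proof (rule sum_mono)
      fix k assume k: "k \<in> {1..N}"
      have "real k powr - t = real k powr - (t + p) * real k powr p"
        by (simp add: powr_add[symmetric])
      also have "\<dots> \<le> real k powr - (t + p) * real N powr p"
        using k assms by (intro mult_left_mono powr_mono2) auto
      finally show "real k powr - t \<le> real k powr - (t + p) * real N powr p" .
    qed
    also have "\<dots> \<le> C * real N powr p"
      unfolding sum_distrib_right[symmetric] C_def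
      by (intro mult_right_mono sum_le_suminf[OF sm]) auto
    finally show ?thesis .
  qed
qed

lemma sum_half_powers_le:
  assumes "finite T" "T \<subseteq> {m..}"
  shows "(\<Sum>n\<in>T. (1 / 2 :: real) ^ n) \<le> 2 * (1 / 2) ^ m"
proof -
  have inj: "inj_on (\<lambda>n. n - m) T"
  proof (rule inj_onI)
    fix i j assume "i \<in> T" "j \<in> T" "i - m = j - m"
    moreover from this have "m \<le> i" "m \<le> j" using assms(2) by auto
    ultimately show "i = j" by simp
  qed
  have "(\<Sum>n\<in>T. (1 / 2 :: real) ^ n) = (\<Sum>n\<in>T. (1 / 2) ^ m * (1 / 2) ^ (n - m))"
    using assms(2) by (intro sum.cong) (auto simp: power_add[symmetric])
  also have "\<dots> = (1 / 2) ^ m * (\<Sum>i\<in>(\<lambda>n. n - m) ` T. (1 / 2) ^ i)"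
    by (simp add: sum.reindex[OF inj] sum_distrib_left)
  also have "(\<Sum>i\<in>(\<lambda>n. n - m) ` T. (1 / 2 :: real) ^ i) \<le> (\<Sum>i. (1 / 2) ^ i)"
    using assms(1) by (intro sum_le_suminf summable_geometric) auto
  also have "(\<Sum>i. (1 / 2 :: real) ^ i) = 2" by (subst suminf_geometric) auto
  finally show ?thesis by (simp add: mult.commute)
qed

text \<open>
  Fix \<open>1 - t < p < r < \<alpha>\<close>. A point of \<open>F\<close> has, for infinitely many \<open>n\<close>, its first \<open>n\<close> digits in
  \<open>{1..N n}\<close> where \<open>N n\<close> is about \<open>n powr (1 / r)\<close>. The corresponding cylinders have diameter at most
  \<open>\<Prod>k\<in>S. 1 / k\<close>, so the sum \<open>q n\<close> of their \<open>t\<close>-th powers is an elementary symmetric polynomial in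
  numbers with sum at most \<open>C * n powr b\<close>, \<open>b = p / r < 1\<close>. The choice \<open>z = n powr (1 - b)\<close> gives
  \<open>q n \<le> (exp C / n powr (1 - b)) ^ n\<close>, which decays faster than any geometric sequence; hence the
  cylinders of all large orders together form a cover of arbitrarily small \<open>t\<close>-sum.
\<close>

lemma hausdorff_measure_superlevel_eq_0:
  assumes t: "1 - \<alpha> < t" "0 < t" "t < 1"
    and F: "F \<subseteq> {x \<in> {0..1}. \<alpha> \<le> convergence_exponent x}"
  shows "hausdorff_measure t F = 0"
proof -
  obtain r where r: "1 - t < r" "r < \<alpha>" using dense[of "1 - t" \<alpha>] t by auto
  obtain p where p: "1 - t < p" "p < r" using dense[OF r(1)] by auto
  define b where "b = p / r"
  have b: "0 \<le> b" "b < 1" using p t by (auto simp: b_def field_simps)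
  define N where "N n = nat \<lfloor>real n powr (1 / r)\<rfloor>" for n
  define q where "q n = (\<Sum>S | S \<subseteq> {1..N n} \<and> card S = n. \<Prod>k\<in>S. real k powr - t)" for n
  obtain C where C: "0 \<le> C" "\<And>N. (\<Sum>k\<in>{1..N}. real k powr - t) \<le> C * real N powr p"
    using sum_powr_le[of t p] p t by auto
  have q_le: "q n \<le> (exp C / real n powr (1 - b)) ^ n" if n: "0 < n" for n
  proof -
    define z where "z = real n powr (1 - b)"
    have z: "0 < z" using n by (simp add: z_def)
    have "real (N n) powr p \<le> (real n powr (1 / r)) powr p"
      using p t by (intro powr_mono2) (auto simp: N_def)
    also have "\<dots> = real n powr b" by (simp add: powr_powr b_def)
    finally have "(\<Sum>k\<in>{1..N n}. real k powr - t) \<le> C * real n powr b"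
      using C by (meson mult_left_mono order_trans)
    then have "z * (\<Sum>k\<in>{1..N n}. real k powr - t) \<le> z * (C * real n powr b)"
      using z by (intro mult_left_mono) auto
    also have "\<dots> = real n * C"
      using n by (simp add: z_def powr_add[symmetric] ac_simps)
    finally have "exp (z * (\<Sum>k\<in>{1..N n}. real k powr - t)) / z ^ n \<le> exp (real n * C) / z ^ n"
      using z by (intro divide_right_mono) auto
    also have "\<dots> = (exp C / z) ^ n" by (simp add: exp_of_nat_mult power_divide)
    finally show ?thesis
      using sum_subset_products_le[of "{1..N n}" "\<lambda>k. real k powr - t" z n] z
      by (simp add: q_def z_def)
  qed
  have "((\<lambda>n. exp C * real n powr - (1 - b)) \<longlonglongrightarrow> exp C * 0)"
    using b by (intro tendsto_intros tendsto_neg_powr filterlim_real_sequentially) auto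
  from order_tendstoD(2)[OF this, of "1 / 2"]
  have "\<forall>\<^sub>F n in sequentially. exp C * real n powr - (1 - b) < 1 / 2" by simp
  then have "\<forall>\<^sub>F n in sequentially. q n \<le> (1 / 2) ^ n"
    using eventually_gt_at_top[of 0]
  proof eventually_elim
    case (elim n)
    have "exp C / real n powr (1 - b) \<le> 1 / 2"
      using elim(1) powr_minus_divide[of "real n" "1 - b"] by simp
    then have "(exp C / real n powr (1 - b)) ^ n \<le> (1 / 2) ^ n"
      by (intro power_mono) auto
    then show ?case using q_le[OF elim(2)] by linarith
  qed
  then obtain n0 where n0: "\<And>n. n0 \<le> n \<Longrightarrow> q n \<le> (1 / 2) ^ n"
    by (auto simp: eventually_sequentially)
  show ?thesis
  proof (rule hausdorff_measure_eq_0I[where 'i = "nat set"])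
    fix \<epsilon> :: real assume "0 < \<epsilon>"
    have "((\<lambda>n. 2 * (1 / 2 :: real) ^ n) \<longlonglongrightarrow> 2 * 0)"
      by (intro tendsto_intros LIMSEQ_power_zero) auto
    then have "\<forall>\<^sub>F n in sequentially. 2 * (1 / 2 :: real) ^ n < \<epsilon> \<and> n0 \<le> n"
      using \<open>0 < \<epsilon>\<close> by (intro eventually_conj order_tendstoD eventually_ge_at_top) auto
    then obtain m where m: "2 * (1 / 2 :: real) ^ m < \<epsilon>" "n0 \<le> m"
      using eventually_happens'[OF sequentially_bot] by blast
    define I where "I = {S. finite S \<and> m \<le> card S \<and> S \<subseteq> {1..N (card S)}}"
    have "countable I"
      by (rule countable_subset[OF _ countable_Collect_finite]) (auto simp: I_def)
    moreover have "F \<subseteq> (\<Union>S\<in>I. cylinder S)"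
    proof
      fix x assume x: "x \<in> F"
      then have "x \<in> {0..1}" "\<alpha> \<le> convergence_exponent x" using F by auto
      then obtain n where n: "m \<le> n" "(pierce_T ^^ n) x \<noteq> 0"
          "real (digit n x) \<le> real (Suc n) powr (1 / r)"
        using frequently_small_digit[of x r m] r t by auto
      \<comment> \<open>Digits are numbered from 0, so these are \<open>n + 1\<close> digits, bounded by \<open>N (n + 1)\<close>.\<close>
      define S where "S = (\<lambda>k. digit k x) ` {..n}"
      have S: "x \<in> cylinder S" "card S = Suc n" "S \<subseteq> {1..digit n x}"
        using mem_cylinder_digit_image[of x n] \<open>x \<in> {0..1}\<close> n unfolding S_def by auto
      have "digit n x \<le> N (Suc n)" using n(3) by (simp add: N_def le_nat_floor)
      then have "S \<in> I" using S n(1) by (auto simp: I_def S_def)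
      then show "x \<in> (\<Union>S\<in>I. cylinder S)" using S(1) by blast
    qed
    moreover have "\<forall>S\<in>I. bounded (cylinder S)"
      by (auto simp: I_def diameter_cylinder_le)
    moreover have "(\<Sum>S\<in>J. diameter (cylinder S) powr t) \<le> \<epsilon>" if J: "J \<subseteq> I" "finite J" for J
    proof -
      have diam: "diameter (cylinder S) powr t \<le> (\<Prod>k\<in>S. real k powr - t)" if "S \<in> J" for S
      proof -
        have S: "finite S" "\<And>k. k \<in> S \<Longrightarrow> 0 < k" using that J by (force simp: I_def)+
        have "diameter (cylinder S) powr t \<le> (1 / (\<Prod>k\<in>S. real k)) powr t"
          using t diameter_cylinder_le[OF S(1)] by (intro powr_mono2 diameter_ge_0) auto
        also have "\<dots> = (\<Prod>k\<in>S. real k powr - t)"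
          by (simp add: powr_divide prod_powr_distrib powr_minus_divide prod_dividef prod_nonneg)
        finally show ?thesis .
      qed
      have "(\<Sum>S\<in>J. diameter (cylinder S) powr t) \<le> (\<Sum>S\<in>J. \<Prod>k\<in>S. real k powr - t)"
        using diam by (rule sum_mono)
      also have "\<dots> = (\<Sum>n\<in>card ` J. \<Sum>S | S \<in> J \<and> card S = n. \<Prod>k\<in>S. real k powr - t)"
        using J(2) by (intro sum.group[symmetric]) auto
      also have "\<dots> \<le> (\<Sum>n\<in>card ` J. (1 / 2) ^ n)"
      proof (rule sum_mono)
        fix n assume "n \<in> card ` J"
        then have "n0 \<le> n" using J m(2) by (auto simp: I_def)
        have "(\<Sum>S | S \<in> J \<and> card S = n. \<Prod>k\<in>S. real k powr - t) \<le> q n"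
          unfolding q_def using J by (intro sum_mono2) (auto simp: I_def intro!: prod_nonneg)
        then show "(\<Sum>S | S \<in> J \<and> card S = n. \<Prod>k\<in>S. real k powr - t) \<le> (1 / 2) ^ n"
          using n0[OF \<open>n0 \<le> n\<close>] by linarith
      qed
      also have "\<dots> \<le> 2 * (1 / 2) ^ m"
        using J by (intro sum_half_powers_le) (auto simp: I_def)
      finally show ?thesis using m(1) by linarith
    qed
    ultimately show "\<exists>(I :: nat set set) U. countable I \<and> F \<subseteq> (\<Union>i\<in>I. U i) \<and>
        (\<forall>i\<in>I. bounded (U i)) \<and> (\<forall>J\<subseteq>I. finite J \<longrightarrow> (\<Sum>j\<in>J. diameter (U j) powr t) \<le> \<epsilon>)"
      by blast
  qed (use t in simp)
qed

section \<open>Mixed radix expansions\<close>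

text \<open>
  Expansions of \<open>y \<in> {0..<1}\<close> with respect to the varying radices \<open>M 0, M 1, \<dots>\<close>: \<open>radix_rem M n y\<close> is
  the fractional part left after \<open>n\<close> digits.
\<close>

primrec radix_rem :: "(nat \<Rightarrow> nat) \<Rightarrow> nat \<Rightarrow> real \<Rightarrow> real" where
  "radix_rem M 0 y = y"
| "radix_rem M (Suc n) y = frac (real (M n) * radix_rem M n y)"

definition radix_digit :: "(nat \<Rightarrow> nat) \<Rightarrow> nat \<Rightarrow> real \<Rightarrow> nat" where
  "radix_digit M n y = nat \<lfloor>real (M n) * radix_rem M n y\<rfloor>"

lemma radix_rem_unit:
  assumes "y \<in> {0..<1}"
  shows "radix_rem M n y \<in> {0..<1}"
proof (cases n)
  case 0
  then show ?thesis using assms by simp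
next
  case (Suc k)
  then show ?thesis by (simp only: radix_rem.simps atLeastLessThan_iff frac_ge_0 frac_lt_1 simp_thms)
qed

lemma radix_rem_Suc:
  assumes "y \<in> {0..<1}"
  shows "radix_rem M (Suc n) y = real (M n) * radix_rem M n y - real (radix_digit M n y)"
proof -
  have "0 \<le> real (M n) * radix_rem M n y" using radix_rem_unit[OF assms, of M n] by simp
  then show ?thesis by (simp add: frac_def radix_digit_def)
qed

lemma radix_digit_less:
  assumes y: "y \<in> {0..<1}" and M: "0 < M n"
  shows "radix_digit M n y < M n"
proof -
  have "0 \<le> real (M n) * radix_rem M n y" using radix_rem_unit[OF y, of M n] by simp
  then have "real (radix_digit M n y) \<le> real (M n) * radix_rem M n y"
    by (simp add: radix_digit_def)
  also have "\<dots> < real (M n) * 1"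
    using radix_rem_unit[OF y, of M n] M by (intro mult_strict_left_mono) auto
  finally show ?thesis by simp
qed

lemma radix_common_prefix:
  assumes y: "y \<in> {0..<1}" and z: "z \<in> {0..<1}"
    and eq: "\<And>k. k < n \<Longrightarrow> radix_digit M k y = radix_digit M k z"
  shows "(\<Prod>k<n. real (M k)) * \<bar>y - z\<bar> \<le> 1"
proof -
  have "radix_rem M n y - radix_rem M n z = (\<Prod>k<n. real (M k)) * (y - z)"
    using eq
  proof (induction n)
    case (Suc n)
    have "radix_rem M (Suc n) y - radix_rem M (Suc n) z =
        real (M n) * (radix_rem M n y - radix_rem M n z)"
      using Suc.prems[OF lessI] by (simp only: radix_rem_Suc[OF y] radix_rem_Suc[OF z] algebra_simps)
    then show ?case using Suc by simp
  qed simp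
  then have "(\<Prod>k<n. real (M k)) * \<bar>y - z\<bar> = \<bar>radix_rem M n y - radix_rem M n z\<bar>"
    by (simp add: abs_mult abs_prod)
  also have "\<dots> \<le> 1"
    using radix_rem_unit[OF y, of M n] radix_rem_unit[OF z, of M n] by (auto simp: abs_le_iff)
  finally show ?thesis .
qed

text \<open>
  If all digits agreed, common prefixes of every length \<open>n\<close> would force \<open>\<bar>y - z\<bar> \<le> 1 / 2 ^ n\<close>.
\<close>

lemma radix_first_difference:
  assumes y: "y \<in> {0..<1}" and z: "z \<in> {0..<1}" and "y \<noteq> z" and M: "\<And>k. 2 \<le> M k"
  obtains n where "\<And>k. k < n \<Longrightarrow> radix_digit M k y = radix_digit M k z"
    "radix_digit M n y \<noteq> radix_digit M n z"
proof -
  have "\<exists>n. radix_digit M n y \<noteq> radix_digit M n z"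
  proof (rule ccontr)
    assume "\<not> ?thesis"
    then have le: "(\<Prod>k<n. real (M k)) * \<bar>y - z\<bar> \<le> 1" for n
      using radix_common_prefix[OF y z] by simp
    obtain n where n: "1 / \<bar>y - z\<bar> < 2 ^ n" using real_arch_pow[of 2] by auto
    have "(2::real) ^ n = (\<Prod>k<n. 2)" by simp
    also have "\<dots> \<le> (\<Prod>k<n. real (M k))"
    proof (rule prod_mono)
      show "0 \<le> (2::real) \<and> 2 \<le> real (M k)" for k using M[of k] by simp
    qed
    finally have "1 / \<bar>y - z\<bar> < (\<Prod>k<n. real (M k))" using n by simp
    then show False using le[of n] \<open>y \<noteq> z\<close> by (simp add: field_simps)
  qed
  then have *: "radix_digit M (LEAST n. radix_digit M n y \<noteq> radix_digit M n z) y \<noteq>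
      radix_digit M (LEAST n. radix_digit M n y \<noteq> radix_digit M n z) z"
    by (rule LeastI_ex)
  show ?thesis by (rule that[OF _ *]) (use not_less_Least in fast)
qed

section \<open>Points whose digits lie in consecutive blocks\<close>

definition block_set :: "(nat \<Rightarrow> nat) \<Rightarrow> real set" where
  "block_set m = {x \<in> {0..1}. \<forall>k. (pierce_T ^^ k) x \<noteq> 0 \<and> m k \<le> digit k x \<and> digit k x < m (Suc k)}"

text \<open>
  The map that serves as \<open>h\<close> in hausdorff_measure_nonzeroI: it copies the \<open>k\<close>-th mixed radix digit of
  \<open>y\<close>, which ranges over \<open>m (k + 1) - m k\<close> values, to the \<open>k\<close>-th Pierce digit inside its block.
\<close>

definition block_point :: "(nat \<Rightarrow> nat) \<Rightarrow> real \<Rightarrow> real" where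
  "block_point m y = pierce_point (\<lambda>k. m k + radix_digit (\<lambda>k. m (Suc k) - m k) k y)"

lemma block_point_digits:
  assumes m: "1 \<le> m 0" "\<And>k. m k + 2 \<le> m (Suc k)" and y: "y \<in> {0..<1}"
  shows "digit k (block_point m y) = m k + radix_digit (\<lambda>k. m (Suc k) - m k) k y"
    and "block_point m y \<in> block_set m"
proof -
  define d where "d = (\<lambda>k. m k + radix_digit (\<lambda>k. m (Suc k) - m k) k y)"
  have "radix_digit (\<lambda>k. m (Suc k) - m k) k y < m (Suc k) - m k" for k
    using m(2)[of k] by (intro radix_digit_less[OF y]) simp
  then have block: "m k \<le> d k" "d k < m (Suc k)" for k
    by (simp_all add: d_def less_diff_conv add.commute)
  have "d k < d (Suc k)" for k using block[of k] block[of "Suc k"] by linarith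
  then have d: "strict_mono d" "1 \<le> d 0"
    using block(1)[of 0] m(1) by (auto simp: strict_mono_Suc_iff)
  have eq: "block_point m y = pierce_point d" by (simp add: block_point_def d_def)
  show "digit k (block_point m y) = m k + radix_digit (\<lambda>k. m (Suc k) - m k) k y"
    unfolding eq pierce_point_digits(3)[OF d] by (simp add: d_def)
  show "block_point m y \<in> block_set m"
    unfolding block_set_def eq using pierce_point_digits[OF d] block by auto
qed

text \<open>
  The first \<open>n\<close> digits contribute the slope of \<open>pierce_T ^^ n\<close>, the factor \<open>m (n + 2)\<^sup>2\<close> comes from the
  gap after the first difference. Replacing digits by the ends of their blocks is wasteful, but the
  products over \<open>k < n\<close> grow so fast that the loss is harmless.
\<close>

lemma block_set_separation:
  assumes m: "\<And>k. m k \<le> m (Suc k)" and x: "x \<in> block_set m" and y: "y \<in> block_set m"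
    and eq: "\<And>k. k < n \<Longrightarrow> digit k x = digit k y" and neq: "digit n x \<noteq> digit n y"
  shows "1 / ((\<Prod>k<n. real (m (Suc k))) * (real (m (n + 2)))\<^sup>2) \<le> \<bar>x - y\<bar>"
proof -
  have unit: "x \<in> {0..1}" "y \<in> {0..1}" using x y by (auto simp: block_set_def)
  have nz: "(pierce_T ^^ k) x \<noteq> 0" "(pierce_T ^^ k) y \<noteq> 0" for k
    using x y by (auto simp: block_set_def)
  have pos: "0 < digit k u" "digit k u < m (Suc k)" if "u \<in> block_set m" for k u
    using that pierce_orbit_step(1)[of u k] by (auto simp: block_set_def)
  let ?D = "\<bar>(pierce_T ^^ n) x - (pierce_T ^^ n) y\<bar>"
  have gap: "1 / (real (m (n + 2)))\<^sup>2 \<le> 1 / (real (digit n u) * (real (digit (Suc n) u) + 1))"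
    if u: "u \<in> block_set m" for u
  proof -
    have "digit n u \<le> m (n + 2)" using pos(2)[OF u, of n] m[of "Suc n"] by simp
    moreover have "digit (Suc n) u + 1 \<le> m (n + 2)" using pos(2)[OF u, of "Suc n"] by simp
    ultimately have "digit n u * (digit (Suc n) u + 1) \<le> m (n + 2) * m (n + 2)"
      by (rule mult_le_mono)
    then have "real (digit n u * (digit (Suc n) u + 1)) \<le> real (m (n + 2) * m (n + 2))"
      by (rule of_nat_mono)
    then have "real (digit n u) * (real (digit (Suc n) u) + 1) \<le> (real (m (n + 2)))\<^sup>2"
      by (simp add: power2_eq_square algebra_simps)
    moreover have "0 < real (digit n u) * (real (digit (Suc n) u) + 1)"
      using pos(1)[OF u, of n] by (intro mult_pos_pos) auto
    ultimately show ?thesis by (simp add: frac_le)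
  qed
  have D: "1 / (real (m (n + 2)))\<^sup>2 \<le> ?D"
  proof (cases "digit n x < digit n y")
    case True
    from pierce_separation[OF unit(1) nz(1) unit(2) nz(2) True] show ?thesis
      using gap[OF y] by linarith
  next
    case False
    then have "digit n y < digit n x" using neq by simp
    from pierce_separation[OF unit(2) nz(2) unit(1) nz(1) this] show ?thesis
      using gap[OF x] abs_minus_commute[of "(pierce_T ^^ n) x" "(pierce_T ^^ n) y"] by linarith
  qed
  have prod_le: "(\<Prod>k<n. real (digit k x)) \<le> (\<Prod>k<n. real (m (Suc k)))"
    using pos(2)[OF x] by (intro prod_mono) (auto intro: less_imp_le)
  have prod_pos: "0 < (\<Prod>k<n. real (digit k x))" using pos(1)[OF x] by (intro prod_pos) auto
  have "1 / ((\<Prod>k<n. real (m (Suc k))) * (real (m (n + 2)))\<^sup>2) =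
      1 / (real (m (n + 2)))\<^sup>2 / (\<Prod>k<n. real (m (Suc k)))" by (simp add: mult.commute)
  also have "\<dots> \<le> ?D / (\<Prod>k<n. real (digit k x))"
    using D prod_le prod_pos by (intro frac_le) auto
  also have "?D = (\<Prod>k<n. real (digit k x)) * \<bar>x - y\<bar>"
    by (rule pierce_orbit_diff[OF unit nz eq])
  also have "\<dots> / (\<Prod>k<n. real (digit k x)) = \<bar>x - y\<bar>"
    by (rule nonzero_mult_div_cancel_left[OF less_imp_neq[OF prod_pos, symmetric]])
  finally show ?thesis .
qed

lemma eventually_decreasing_bounded:
  fixes r :: "nat \<Rightarrow> real"
  assumes "\<forall>\<^sub>F n in sequentially. r (Suc n) \<le> r n"
  obtains K where "\<And>n. r n \<le> K"
proof -
  obtain N where N: "\<And>n. N \<le> n \<Longrightarrow> r (Suc n) \<le> r n"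
    using assms by (auto simp: eventually_sequentially)
  define K where "K = Max (r ` {..N})"
  have small: "r n \<le> K" if "n \<le> N" for n using that by (simp add: K_def)
  have "r n \<le> K" if "N \<le> n" for n
    using that
  proof (induction n rule: dec_induct)
    case (step n)
    then show ?case using N[of n] by linarith
  qed (use small in simp)
  then show ?thesis using small that by (meson nat_le_linear)
qed

text \<open>
  Points \<open>y, z\<close> whose mixed radix expansions first differ at place \<open>n\<close> are at distance at most
  \<open>1 / P n\<close>, their images at distance at least \<open>1 / Q n\<close>, where \<open>P n\<close> is the product of the first \<open>n\<close>
  block lengths and \<open>Q n\<close> the denominator in the separation estimate. The required Hoelder bound is
  therefore the boundedness of \<open>Q n powr t / P n\<close>. Passing from \<open>n\<close> to \<open>n + 1\<close> multiplies this
  quotient by at most \<open>(B\<^sup>2 * m (n + 1)) powr t / (m (n + 1) - m n)\<close>, and the hypothesis on the gaps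
  says that this factor is eventually at most 1.
\<close>

lemma hausdorff_measure_block_set_nonzero:
  fixes B t :: real
  assumes m: "1 \<le> m 0" "\<And>k. m k + 2 \<le> m (Suc k)" and t: "0 \<le> t"
    and B: "\<And>n. real (m (Suc n)) \<le> B * real (m n)"
    and ev: "\<forall>\<^sub>F n in sequentially. (B\<^sup>2 * real (m (Suc n))) powr t \<le> real (m (Suc n) - m n)"
    and F: "block_set m \<subseteq> F"
  shows "hausdorff_measure t F \<noteq> 0"
proof -
  define M where "M k = m (Suc k) - m k" for k
  have M: "2 \<le> M k" for k using m(2)[of k] by (simp add: M_def)
  have m_pos: "0 < m k" for k using m by (cases k) (auto intro: less_le_trans[OF _ m(2)])
  define P where "P n = (\<Prod>k<n. real (M k))" for n
  define Q where "Q n = (\<Prod>k<n. real (m (Suc k))) * (real (m (n + 2)))\<^sup>2" for n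
  have P: "0 < P n" for n
    unfolding P_def using M by (intro prod_pos) (auto intro: less_le_trans[of 0 2])
  have Q: "0 < Q n" for n
    unfolding Q_def using m_pos by (intro mult_pos_pos prod_pos) auto
  have Q_Suc: "Q (Suc n) \<le> Q n * (B\<^sup>2 * real (m (Suc n)))" for n
  proof -
    have "(real (m (Suc n + 2)))\<^sup>2 \<le> (B * real (m (n + 2)))\<^sup>2"
      using B[of "n + 2"] by (intro power_mono) auto
    then have "(\<Prod>k<Suc n. real (m (Suc k))) * (real (m (Suc n + 2)))\<^sup>2 \<le>
        (\<Prod>k<Suc n. real (m (Suc k))) * (B * real (m (n + 2)))\<^sup>2"
      by (intro mult_left_mono prod_nonneg) auto
    then show ?thesis by (simp add: Q_def power_mult_distrib mult_ac)
  qed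
  have "\<forall>\<^sub>F n in sequentially. Q (Suc n) powr t / P (Suc n) \<le> Q n powr t / P n"
    using ev
  proof eventually_elim
    case (elim n)
    have "Q (Suc n) powr t \<le> (Q n * (B\<^sup>2 * real (m (Suc n)))) powr t"
      using Q_Suc Q[of "Suc n"] t by (intro powr_mono2) auto
    also have "\<dots> = Q n powr t * (B\<^sup>2 * real (m (Suc n))) powr t"
      using Q[of n] by (simp add: powr_mult)
    also have "\<dots> \<le> Q n powr t * real (M n)"
      using elim by (intro mult_left_mono) (auto simp: M_def)
    finally have "Q (Suc n) powr t / P (Suc n) \<le> Q n powr t * real (M n) / P (Suc n)"
      using P[of "Suc n"] by (intro divide_right_mono) auto
    also have "\<dots> = Q n powr t / P n" using M[of n] by (simp add: P_def)
    finally show ?case .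
  qed
  then obtain K where K: "\<And>n. Q n powr t / P n \<le> K"
    using eventually_decreasing_bounded[of "\<lambda>n. Q n powr t / P n"] by blast
  have K0: "0 \<le> K" using K[of 0] P[of 0] by (meson divide_nonneg_pos order_trans powr_ge_zero)
  show ?thesis
  proof (rule hausdorff_measure_nonzeroI[OF t, of "block_point m"])
    fix y :: real assume "y \<in> {0..<1}"
    then show "block_point m y \<in> F" using block_point_digits(2)[of m, OF m] F by blast
  next
    fix y z :: real assume y: "y \<in> {0..<1}" and z: "z \<in> {0..<1}"
    show "\<bar>y - z\<bar> \<le> K * dist (block_point m y) (block_point m z) powr t"
    proof (cases "y = z")
      case True
      then show ?thesis using K0 by simp
    next
      case False
      obtain n where n: "\<And>k. k < n \<Longrightarrow> radix_digit M k y = radix_digit M k z"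
          "radix_digit M n y \<noteq> radix_digit M n z"
        using radix_first_difference[of y z M] y z False M by blast
      have M_eta: "M = (\<lambda>k. m (Suc k) - m k)" by (simp add: fun_eq_iff M_def)
      have far: "1 / Q n \<le> dist (block_point m y) (block_point m z)"
        unfolding Q_def dist_real_def
      proof (rule block_set_separation[of m])
        show "m k \<le> m (Suc k)" for k using m(2)[of k] by simp
        show "digit k (block_point m y) = digit k (block_point m z)" if "k < n" for k
          using n(1)[OF that] unfolding block_point_digits(1)[of m, OF m y] block_point_digits(1)[of m, OF m z]
          by (simp add: M_eta)
        show "digit n (block_point m y) \<noteq> digit n (block_point m z)"
          using n(2) unfolding block_point_digits(1)[of m, OF m y] block_point_digits(1)[of m, OF m z]
          by (simp add: M_eta)
      qed (use block_point_digits(2)[of m, OF m] y z in auto)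
      have "\<bar>y - z\<bar> \<le> 1 / P n"
        using radix_common_prefix[OF y z n(1)] P[of n] by (simp add: P_def field_simps)
      also have "\<dots> = (Q n powr t / P n) * (1 / Q n) powr t"
        using Q[of n] by (simp add: powr_divide)
      also have "\<dots> \<le> K * dist (block_point m y) (block_point m z) powr t"
        using K K0 far Q[of n] t by (intro mult_mono powr_mono2) auto
      finally show ?thesis .
    qed
  qed
qed

lemma block_set_nonempty:
  assumes m: "1 \<le> m 0" "\<And>k. m k + 2 \<le> m (Suc k)"
  shows "block_set m \<noteq> {}"
proof -
  have "(0::real) \<in> {0..<1}" by simp
  with m have "block_point m 0 \<in> block_set m" by (intro block_point_digits(2)[of m 0])
  then show ?thesis by blast
qed

section \<open>Blocks with polynomial growth\<close>

text \<open>
  The growth rate \<open>k powr (1 / \<alpha>)\<close> is what gives the digit series the exponent \<open>\<alpha>\<close>. The factor 3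
  compensates for the rounding and leaves at least two elements in every block, also for \<open>\<alpha> = 1\<close>.
\<close>

definition poly_block :: "real \<Rightarrow> nat \<Rightarrow> nat" where
  "poly_block a k = nat \<lfloor>3 * real (Suc k) powr a\<rfloor>"

lemma poly_block_bounds:
  assumes a: "1 \<le> a"
  shows "2 * real (Suc k) powr a \<le> real (poly_block a k)"
    and "real (poly_block a k) \<le> 3 * real (Suc k) powr a"
    and "real (poly_block a k) + 2 * real (Suc k) powr (a - 1) \<le> real (poly_block a (Suc k))"
proof -
  have one: "1 \<le> real (Suc k) powr b" if "0 \<le> b" for k b
    using that by (intro ge_one_powr_ge_zero) auto
  have eq: "real (poly_block a k) = of_int \<lfloor>3 * real (Suc k) powr a\<rfloor>" for k
    by (simp add: poly_block_def)
  show "2 * real (Suc k) powr a \<le> real (poly_block a k)"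
    using one[of a k] a unfolding eq by linarith
  show le: "real (poly_block a k) \<le> 3 * real (Suc k) powr a"
    unfolding eq by linarith
  have "real (Suc k) powr a + real (Suc k) powr (a - 1) =
      real (Suc k) powr (a - 1) * real (Suc (Suc k))"
    by (simp add: powr_diff field_simps)
  also have "\<dots> \<le> real (Suc (Suc k)) powr (a - 1) * real (Suc (Suc k))"
    using a by (intro mult_right_mono powr_mono2) auto
  also have "\<dots> = real (Suc (Suc k)) powr a" by (simp add: powr_diff)
  finally have "real (Suc k) powr a + real (Suc k) powr (a - 1) \<le> real (Suc (Suc k)) powr a" .
  moreover have "3 * real (Suc (Suc k)) powr a - 1 \<le> real (poly_block a (Suc k))"
    unfolding eq by linarith
  ultimately show "real (poly_block a k) + 2 * real (Suc k) powr (a - 1) \<le> real (poly_block a (Suc k))"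
    using le one[of "a - 1" k] a by linarith
qed

lemma poly_block_step:
  assumes a: "1 \<le> a"
  shows "1 \<le> poly_block a 0" "poly_block a k + 2 \<le> poly_block a (Suc k)"
    "real (poly_block a (Suc k)) \<le> 3 * 2 powr a * real (Suc k) powr a"
proof -
  show "1 \<le> poly_block a 0" by (simp add: poly_block_def)
  have "1 \<le> real (Suc k) powr (a - 1)" using a by (intro ge_one_powr_ge_zero) auto
  then have "real (poly_block a k + 2) \<le> real (poly_block a (Suc k))"
    using poly_block_bounds(3)[OF a, of k] by simp
  then show "poly_block a k + 2 \<le> poly_block a (Suc k)" by (simp only: of_nat_le_iff)
  have "real (Suc (Suc k)) powr a \<le> (2 * real (Suc k)) powr a"
    using a by (intro powr_mono2) auto
  also have "\<dots> = 2 powr a * real (Suc k) powr a" by (intro powr_mult)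
  finally show "real (poly_block a (Suc k)) \<le> 3 * 2 powr a * real (Suc k) powr a"
    using poly_block_bounds(2)[OF a, of "Suc k"] by linarith
qed

lemma block_set_poly_convergence_exponent:
  assumes \<alpha>: "0 < \<alpha>" "\<alpha> \<le> 1" and x: "x \<in> block_set (poly_block (1 / \<alpha>))"
  shows "convergence_exponent x = \<alpha>"
proof (rule convergence_exponent_eqI)
  let ?m = "poly_block (1 / \<alpha>)"
  have a: "1 \<le> 1 / \<alpha>" using \<alpha> by simp
  have digit_term: "inverse_enat_powr (pierce_digit (Suc n) x) s = 1 / real (digit n x) powr s" for n s
    using x by (simp add: block_set_def pierce_digit_Suc inverse_enat_powr_enat)
  have lo: "real (Suc n) powr (1 / \<alpha>) \<le> real (digit n x)" for n
  proof -
    have "?m n \<le> digit n x" using x by (simp add: block_set_def)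
    then show ?thesis using poly_block_bounds(1)[OF a, of n] powr_ge_zero[of "real (Suc n)" "1 / \<alpha>"]
      by linarith
  qed
  have hi: "real (digit n x) \<le> 3 * 2 powr (1 / \<alpha>) * real (Suc n) powr (1 / \<alpha>)" for n
  proof -
    have "digit n x \<le> ?m (Suc n)" using x by (simp add: block_set_def less_imp_le)
    then show ?thesis using poly_block_step(3)[OF a, of n] by linarith
  qed
  show "summable (\<lambda>n. inverse_enat_powr (pierce_digit (Suc n) x) s)" if s: "\<alpha> < s" for s
  proof -
    have "summable (\<lambda>n. real n powr - (s / \<alpha>))"
      using \<alpha> s by (subst summable_real_powr_iff) (simp add: field_simps)
    then have "summable (\<lambda>n. real (Suc n) powr - (s / \<alpha>))"
      by (subst summable_Suc_iff)
    then show ?thesis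
    proof (rule summable_comparison_test'[where N = 0])
      fix n
      have "real (Suc n) powr (s / \<alpha>) = (real (Suc n) powr (1 / \<alpha>)) powr s" by (simp add: powr_powr)
      also have "\<dots> \<le> real (digit n x) powr s" using lo \<alpha> s by (intro powr_mono2) auto
      finally have "real (Suc n) powr (s / \<alpha>) \<le> real (digit n x) powr s" .
      moreover have "0 < real (Suc n) powr (s / \<alpha>)" by simp
      ultimately have "1 / real (digit n x) powr s \<le> 1 / real (Suc n) powr (s / \<alpha>)"
        by (intro divide_left_mono mult_pos_pos) linarith+
      then show "norm (inverse_enat_powr (pierce_digit (Suc n) x) s) \<le> real (Suc n) powr - (s / \<alpha>)"
        by (simp add: digit_term powr_minus_divide)
    qed
  qed
  show "\<not> summable (\<lambda>n. inverse_enat_powr (pierce_digit (Suc n) x) s)" if s: "0 < s" "s \<le> \<alpha>" for s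
  proof
    define D where "D = 3 * 2 powr (1 / \<alpha>)"
    have D: "0 < D" by (simp add: D_def)
    assume "summable (\<lambda>n. inverse_enat_powr (pierce_digit (Suc n) x) s)"
    then have "summable (\<lambda>n. D powr s * (1 / real (digit n x) powr s))"
      unfolding digit_term by (rule summable_mult)
    then have "summable (\<lambda>n. real (Suc n) powr - (s / \<alpha>))"
    proof (rule summable_comparison_test'[where N = 0])
      fix n
      have "0 < real (digit n x)" by (rule less_le_trans[OF _ lo]) simp
      then have pos: "0 < real (digit n x) powr s" by simp
      have "real (digit n x) powr s \<le> (D * real (Suc n) powr (1 / \<alpha>)) powr s"
        using hi s by (intro powr_mono2) (auto simp: D_def)
      also have "\<dots> = D powr s * real (Suc n) powr (s / \<alpha>)"
        using D by (simp add: powr_mult powr_powr)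
      finally have "1 / real (Suc n) powr (s / \<alpha>) \<le> D powr s * (1 / real (digit n x) powr s)"
        using pos by (simp add: field_simps)
      then show "norm (real (Suc n) powr - (s / \<alpha>)) \<le> D powr s * (1 / real (digit n x) powr s)"
        by (simp add: powr_minus_divide)
    qed
    then have "summable (\<lambda>n. real n powr - (s / \<alpha>))"
      using summable_Suc_iff[of "\<lambda>n. real n powr - (s / \<alpha>)"] by blast
    then have "- (s / \<alpha>) < - 1" by (subst (asm) summable_real_powr_iff)
    then show False using \<alpha> s by (simp add: field_simps)
  qed
qed (use \<alpha> in simp)

text \<open>
  The block length has order \<open>n powr (a - 1)\<close> and the left-hand side has order \<open>n powr (a * t)\<close>. With
  \<open>a = 1 / \<alpha>\<close>, the condition \<open>a * t < a - 1\<close> is \<open>t < 1 - \<alpha>\<close>: this is where the dimension comes from.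
\<close>

lemma poly_block_gap_dominates:
  assumes a: "1 \<le> a" and t: "a * t < a - 1" "0 \<le> t"
  shows "\<forall>\<^sub>F n in sequentially. (B\<^sup>2 * real (poly_block a (Suc n))) powr t \<le>
    real (poly_block a (Suc n) - poly_block a n)"
proof -
  define D where "D = (B\<^sup>2 * (3 * 2 powr a)) powr t"
  have "((\<lambda>n. D * real (Suc n) powr (a * t - (a - 1))) \<longlonglongrightarrow> D * 0)"
    using t by (intro tendsto_intros tendsto_neg_powr filterlim_compose[OF filterlim_real_sequentially filterlim_Suc]) auto
  from order_tendstoD(2)[OF this, of 1]
  have "\<forall>\<^sub>F n in sequentially. D * real (Suc n) powr (a * t - (a - 1)) < 1" by simp
  then show ?thesis
  proof eventually_elim
    case (elim n)
    have "(B\<^sup>2 * real (poly_block a (Suc n))) powr t \<le> (B\<^sup>2 * (3 * 2 powr a) * real (Suc n) powr a) powr t"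
      using poly_block_step(3)[OF a, of n] t
      by (intro powr_mono2) (auto intro!: mult_left_mono simp: mult.assoc)
    also have "\<dots> = D * real (Suc n) powr (a * t)"
      by (simp add: D_def powr_mult powr_powr)
    also have "\<dots> = D * real (Suc n) powr (a * t - (a - 1)) * real (Suc n) powr (a - 1)"
      by (simp add: powr_add[symmetric])
    also have "\<dots> \<le> 1 * real (Suc n) powr (a - 1)"
      using elim by (intro mult_right_mono) auto
    also have "\<dots> \<le> 2 * real (Suc n) powr (a - 1)" by simp
    also have "\<dots> \<le> real (poly_block a (Suc n) - poly_block a n)"
      using poly_block_bounds(3)[OF a, of n] by linarith
    finally show ?case .
  qed
qed

lemma hausdorff_measure_level_set_nonzero_pos:
  assumes \<alpha>: "0 < \<alpha>" "\<alpha> \<le> 1" and t: "0 \<le> t" "t < 1 - \<alpha>"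
  shows "hausdorff_measure t (pierce_level_set \<alpha>) \<noteq> 0"
proof (rule hausdorff_measure_block_set_nonzero[where m = "poly_block (1 / \<alpha>)" and
      B = "3 * 2 powr (1 / \<alpha>)"])
  have a: "1 \<le> 1 / \<alpha>" using \<alpha> by simp
  show "1 \<le> poly_block (1 / \<alpha>) 0" "\<And>k. poly_block (1 / \<alpha>) k + 2 \<le> poly_block (1 / \<alpha>) (Suc k)"
    using poly_block_step[OF a] by auto
  show "real (poly_block (1 / \<alpha>) (Suc n)) \<le> 3 * 2 powr (1 / \<alpha>) * real (poly_block (1 / \<alpha>) n)" for n
  proof -
    have "real (Suc n) powr (1 / \<alpha>) \<le> real (poly_block (1 / \<alpha>) n)"
      using poly_block_bounds(1)[OF a, of n] powr_ge_zero[of "real (Suc n)" "1 / \<alpha>"] by linarith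
    then have "3 * 2 powr (1 / \<alpha>) * real (Suc n) powr (1 / \<alpha>) \<le>
        3 * 2 powr (1 / \<alpha>) * real (poly_block (1 / \<alpha>) n)" by (intro mult_left_mono) auto
    then show ?thesis using poly_block_step(3)[OF a, of n] by linarith
  qed
  show "\<forall>\<^sub>F n in sequentially. ((3 * 2 powr (1 / \<alpha>))\<^sup>2 * real (poly_block (1 / \<alpha>) (Suc n))) powr t \<le>
      real (poly_block (1 / \<alpha>) (Suc n) - poly_block (1 / \<alpha>) n)"
    using \<alpha> t by (intro poly_block_gap_dominates[OF a]) (auto simp: field_simps)
  show "block_set (poly_block (1 / \<alpha>)) \<subseteq> pierce_level_set \<alpha>"
    using block_set_poly_convergence_exponent[OF \<alpha>] by (auto simp: pierce_level_set_def block_set_def)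
  show "0 \<le> t" by (fact t(1))
qed

section \<open>Blocks with geometric growth\<close>

lemma block_set_geometric_convergence_exponent:
  assumes x: "x \<in> block_set (\<lambda>k. 2 ^ Suc k)"
  shows "convergence_exponent x = 0"
proof (rule convergence_exponent_eqI)
  fix s :: real assume s: "0 < s"
  have digit_term: "inverse_enat_powr (pierce_digit (Suc n) x) s = 1 / real (digit n x) powr s" for n
    using x by (simp add: block_set_def pierce_digit_Suc inverse_enat_powr_enat)
  have "2 powr - s < 1" using s by (simp add: powr_less_one)
  then have "summable (\<lambda>n. (2 powr - s) ^ n)" by (intro summable_geometric) simp
  then show "summable (\<lambda>n. inverse_enat_powr (pierce_digit (Suc n) x) s)"
  proof (rule summable_comparison_test'[where N = 0])
    fix n
    have "2 ^ Suc n \<le> digit n x" using x by (simp add: block_set_def)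
    then have "2 ^ n \<le> digit n x" by simp
    then have le: "2 ^ n \<le> real (digit n x)" by (metis of_nat_le_iff of_nat_numeral of_nat_power)
    have "(2 powr s) ^ n = (2 ^ n) powr s"
      by (simp add: powr_realpow[symmetric] powr_powr mult.commute)
    also have "\<dots> \<le> real (digit n x) powr s" using le s by (intro powr_mono2) auto
    finally have "1 / real (digit n x) powr s \<le> 1 / (2 powr s) ^ n"
      using less_le_trans[OF _ le, of 0] by (intro divide_left_mono mult_pos_pos) auto
    then show "norm (inverse_enat_powr (pierce_digit (Suc n) x) s) \<le> (2 powr - s) ^ n"
      by (simp add: digit_term powr_minus_divide power_divide)
  qed
qed auto

text \<open>
  Here block ends and block lengths both have order \<open>2 ^ n\<close>, so every \<open>t < 1\<close> is admissible.
\<close>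

lemma hausdorff_measure_level_set_0_nonzero:
  assumes t: "0 \<le> t" "t < 1"
  shows "hausdorff_measure t (pierce_level_set 0) \<noteq> 0"
proof (rule hausdorff_measure_block_set_nonzero[where m = "\<lambda>k. 2 ^ Suc k" and B = 2])
  show "2 ^ Suc k + 2 \<le> (2::nat) ^ Suc (Suc k)" for k
    using self_le_power[of 2 "Suc k"] by simp
  show "real (2 ^ Suc (Suc n)) \<le> 2 * real (2 ^ Suc n)" for n by simp
  have "\<forall>\<^sub>F n in sequentially. 4 / (1 - t) \<le> real n"
    using filterlim_real_sequentially by (simp add: filterlim_at_top)
  then show "\<forall>\<^sub>F n in sequentially.
      (2\<^sup>2 * real (2 ^ Suc (Suc n))) powr t \<le> real (2 ^ Suc (Suc n) - 2 ^ Suc n)"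
  proof eventually_elim
    case (elim n)
    then have "4 \<le> real n * (1 - t)" using t by (simp add: field_simps)
    then have le: "(real n + 4) * t \<le> real n + 1" using t by (simp add: algebra_simps)
    have "2\<^sup>2 * real (2 ^ Suc (Suc n)) = 2 powr (real n + 4)"
      by (simp add: powr_add powr_realpow)
    then have "(2\<^sup>2 * real (2 ^ Suc (Suc n))) powr t = 2 powr ((real n + 4) * t)"
      by (simp add: powr_powr)
    also have "\<dots> \<le> 2 powr (real n + 1)" using le by (intro powr_mono) auto
    also have "\<dots> = real (2 ^ Suc (Suc n) - 2 ^ Suc n)"
      by (simp add: powr_add powr_realpow)
    finally show ?case .
  qed
  show "block_set (\<lambda>k. 2 ^ Suc k) \<subseteq> pierce_level_set 0"
    using block_set_geometric_convergence_exponent by (auto simp: pierce_level_set_def block_set_def)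
qed (use t in auto)

section \<open>The dimension of the level sets\<close>

lemma pierce_level_set_nonempty:
  assumes "0 \<le> \<alpha>" "\<alpha> \<le> 1"
  shows "pierce_level_set \<alpha> \<noteq> {}"
proof (cases "\<alpha> = 0")
  case True
  have "convergence_exponent 0 = 0"
  proof (rule convergence_exponent_eqI)
    have "(pierce_T ^^ k) 0 = 0" for k by (rule pierce_orbit_zero_stays[of 0]) auto
    then show "summable (\<lambda>n. inverse_enat_powr (pierce_digit (Suc n) 0) s)" for s
      by (simp add: pierce_digit_Suc inverse_enat_powr_def)
  qed auto
  then have "0 \<in> pierce_level_set \<alpha>" using True by (simp add: pierce_level_set_def)
  then show ?thesis by blast
next
  case False
  then have \<alpha>: "0 < \<alpha>" "1 \<le> 1 / \<alpha>" using assms by auto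
  obtain x where x: "x \<in> block_set (poly_block (1 / \<alpha>))"
    using block_set_nonempty[of "poly_block (1 / \<alpha>)", OF poly_block_step(1,2)[OF \<alpha>(2)]] by blast
  then have "x \<in> pierce_level_set \<alpha>"
    using block_set_poly_convergence_exponent[OF \<alpha>(1) assms(2) x]
    by (simp add: pierce_level_set_def block_set_def)
  then show ?thesis by blast
qed

theorem theorem1p7:
  fixes \<alpha> :: real
  assumes "\<alpha> \<in> {0..1}"
  shows "pierce_level_set \<alpha> \<noteq> {} \<and> hausdorff_dim (pierce_level_set \<alpha>) = ereal (1 - \<alpha>)"
proof
  have \<alpha>: "0 \<le> \<alpha>" "\<alpha> \<le> 1" using assms by auto
  show "pierce_level_set \<alpha> \<noteq> {}" using \<alpha> by (rule pierce_level_set_nonempty)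
  show "hausdorff_dim (pierce_level_set \<alpha>) = ereal (1 - \<alpha>)"
  proof (rule antisym)
    have "hausdorff_dim (pierce_level_set \<alpha>) \<le> ereal (1 - \<alpha>) + ereal e" if e: "0 < e" for e
    proof -
      obtain t where t: "1 - \<alpha> < t" "t < 1 - \<alpha> + e" "hausdorff_measure t (pierce_level_set \<alpha>) = 0"
      proof (cases "\<alpha> = 0")
        case True
        have "hausdorff_measure (1 + e / 2) (pierce_level_set \<alpha>) = 0"
          using e by (intro hausdorff_measure_unit_interval_eq_0) (auto simp: pierce_level_set_def)
        then show ?thesis using that[of "1 + e / 2"] True e by simp
      next
        case False
        \<comment> \<open>Exponents below 1 are available here because \<open>\<alpha> > 0\<close>.\<close>
        then obtain t where t: "1 - \<alpha> < t" "t < min 1 (1 - \<alpha> + e)"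
          using dense[of "1 - \<alpha>" "min 1 (1 - \<alpha> + e)"] \<alpha> e by auto
        then have "hausdorff_measure t (pierce_level_set \<alpha>) = 0"
          using \<alpha> by (intro hausdorff_measure_superlevel_eq_0[of \<alpha>])
            (auto simp: pierce_level_set_def)
        then show ?thesis using that t by simp
      qed
      then have "hausdorff_dim (pierce_level_set \<alpha>) \<le> ereal t"
        unfolding hausdorff_dim_def using \<alpha> by (intro INF_lower) auto
      also have "\<dots> \<le> ereal (1 - \<alpha>) + ereal e" using t by simp
      finally show ?thesis .
    qed
    then show "hausdorff_dim (pierce_level_set \<alpha>) \<le> ereal (1 - \<alpha>)"
      by (rule ereal_le_epsilon2)
    show "ereal (1 - \<alpha>) \<le> hausdorff_dim (pierce_level_set \<alpha>)"
      unfolding hausdorff_dim_def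
    proof (rule INF_greatest)
      fix t assume t: "t \<in> {s. 0 \<le> s \<and> hausdorff_measure s (pierce_level_set \<alpha>) = 0}"
      have "1 - \<alpha> \<le> t"
      proof (rule ccontr)
        assume "\<not> 1 - \<alpha> \<le> t"
        then have "hausdorff_measure t (pierce_level_set \<alpha>) \<noteq> 0"
          using t \<alpha> hausdorff_measure_level_set_0_nonzero[of t]
            hausdorff_measure_level_set_nonzero_pos[of \<alpha> t]
          by (cases "\<alpha> = 0") simp_all
        then show False using t by simp
      qed
      then show "ereal (1 - \<alpha>) \<le> ereal t" by simp
    qed
  qed
qed

end
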